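(* Let $\mathbb{C}\subset^{\varphi_0}B\subset^{\varphi_1}A_1\subset^{\varphi_2}A_2\subset^{\varphi_3}\cdots$ be a tower of amalgamated noncommutative probability spaces, with enveloping space $(A_\infty,E_\infty)$ and $E_j=\varphi_0\varphi_1\cdots\varphi_j:A_j\to\mathbb{C}$. Let $k<l$ in $\mathbb{N}$, $s\in\mathbb{N}$, and let $X=\{x_1,\dots,x_s\}\subset\bigcup_{j=1}^kA_j$ and $Y=\{y_1,\dots,y_s\}\subset\bigcup_{j=k+1}^lA_j$. If $X$ and $Y$ are free in $(A_l,E_l)$, then (1) $r^{(E_\infty)}_{x_1,\dots,x_s,y_1,\dots,y_s}(z_1,\dots,z_{2s})=r^{(E_k)}_{x_1,\dots,x_s}(z_1,\dots,z_s)+r^{(E_l)}_{y_1,\dots,y_s}(z_{s+1},\dots,z_{2s})$; (2) $r^{(E_\infty)}_{x_1+y_1,\dots,x_s+y_s}(z_1,\dots,z_s)=\bigl(r^{(E_k)}_{x_1,\dots,x_s}+r^{(E_l)}_{y_1,\dots,y_s}\bigr)(z_1,\dots,z_s)$; (3) $r^{(E_\infty)}_{x_1y_1,\dots,x_sy_s}(z_1,\dots,z_s)=\bigl(r^{(E_k)}_{x_1,\dots,x_s}\ast_{\mathbb{C}}r^{(E_l)}_{y_1,\dots,y_s}\bigr)(z_1,\dots,z_s)$, where $\ast_{\mathbb{C}}$ denotes the scalar-valued boxed convolution.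
   Context: Algebras are unital and complex. Tower of amalgamated noncommutative probability spaces: a sequence of unital algebras $A_0=B\subset A_1\subset A_2\subset\cdots$, each a unital subalgebra of the next (common unit), a fixed linear functional $\varphi_0:B\to\mathbb{C}$ with $\varphi_0(1)=1$, and for each $n\ge1$ a conditional expectation $\varphi_n:A_n\to A_{n-1}$, i.e. a linear map with $\varphi_n(b)=b$ and $\varphi_n(bxb')=b\varphi_n(x)b'$ for $b,b'\in A_{n-1}$, $x\in A_n$. Juxtaposition means composition. Enveloping space: $A_\infty=\bigcup_jA_j$ and $E_\infty:A_\infty\to\mathbb{C}$ is $E_\infty(x)=E_j(x)$ for $x\in A_j$. $NC(n)$ is the lattice of noncrossing partitions of $\{1,\dots,n\}$ ordered by refinement, $1_n$ its maximal element, $\mu$ its Möbius function, $Kr:NC(n)\to NC(n)$ the Kreweras complement. For a linear functional $E$ on an algebra $A$, the cumulants are $k_n^{(E)}(a_1,\dots,a_n)=\sum_{\pi\in NC(n)}\bigl(\prod_{V=(v_1<\dots<v_p)\in\pi}E(a_{v_1}\cdots a_{v_p})\bigr)\mu(\pi,1_n)$. The R-transform of $a_1,\dots,a_s\in A$ is the formal power series in noncommuting indeterminates $r^{(E)}_{a_1,\dots,a_s}(z_1,\dots,z_s)=\sum_{n\ge1}\sum_{i_1,\dots,i_n\in\{1,\dots,s\}}k_n^{(E)}(a_{i_1},\dots,a_{i_n})z_{i_1}\cdots z_{i_n}$. Subsets $X,Y\subset A$ are free in $(A,E)$ if for the unital subalgebras $A_X,A_Y$ they generate, $k_n^{(E)}(a_1,\dots,a_n)=0$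 whenever $a_1,\dots,a_n\in A_X\cup A_Y$ do not all lie in $A_X$ and do not all lie in $A_Y$ (equivalently, the usual freeness of Voiculescu). Boxed convolution: for formal series $f,g$ in $z_1,\dots,z_s$ without constant term, with coefficients $f_{i_1,\dots,i_n},g_{i_1,\dots,i_n}$, the series $f\ast_{\mathbb{C}}g$ has $(i_1,\dots,i_n)$-th coefficient $\sum_{\pi\in NC(n)}\Bigl(\prod_{V=(v_1<\dots<v_p)\in\pi}f_{i_{v_1},\dots,i_{v_p}}\Bigr)\Bigl(\prod_{W=(w_1<\dots<w_q)\in Kr(\pi)}g_{i_{w_1},\dots,i_{w_q}}\Bigr)$.
   Formalization: Freeness is read as Voiculescu's: mixed cumulants vanish when each entry is taken from A_X or A_Y, with both used, even if an entry lies in both. The literal condition "not all in A_X and not all in A_Y" is void for X=Y, where (1) fails (e.g. x_1=y_1 with nonzero variance). *)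

theory Defs
  imports Complex_Main "HOL-Library.Disjoint_Sets" "HOL-Library.Function_Algebras"
begin

subsection \<open>Unital complex algebras and towers\<close>

locale complex_algebra = vector_space scale
  for scale :: "complex \<Rightarrow> 'a::ring_1 \<Rightarrow> 'a" +
  assumes scale_mult_left: "scale c x * y = scale c (x * y)"
    and scale_mult_right: "x * scale c y = scale c (x * y)"

definition unital_subalgebra :: "(complex \<Rightarrow> 'a::ring_1 \<Rightarrow> 'a) \<Rightarrow> 'a set \<Rightarrow> bool"
  where "unital_subalgebra scale S \<longleftrightarrow>
    module.subspace scale S \<and> 1 \<in> S \<and> (\<forall>x\<in>S. \<forall>y\<in>S. x * y \<in> S)"

definition clinear_on ::
    "(complex \<Rightarrow> 'a::ring_1 \<Rightarrow> 'a) \<Rightarrow> (complex \<Rightarrow> 'b::ring_1 \<Rightarrow> 'b) \<Rightarrow> 'a set \<Rightarrow> ('a \<Rightarrow> 'b) \<Rightarrow> bool"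
  where "clinear_on scale1 scale2 V f \<longleftrightarrow>
    (\<forall>x\<in>V. \<forall>y\<in>V. f (x + y) = f x + f y) \<and> (\<forall>c. \<forall>x\<in>V. f (scale1 c x) = scale2 c (f x))"

definition conditional_expectation ::
    "(complex \<Rightarrow> 'a::ring_1 \<Rightarrow> 'a) \<Rightarrow> 'a set \<Rightarrow> 'a set \<Rightarrow> ('a \<Rightarrow> 'a) \<Rightarrow> bool"
  where "conditional_expectation scale A B F \<longleftrightarrow>
    F ` A \<subseteq> B \<and> clinear_on scale scale A F \<and> (\<forall>b\<in>B. F b = b) \<and>
    (\<forall>b\<in>B. \<forall>b'\<in>B. \<forall>x\<in>A. F (b * x * b') = b * F x * b')"

text \<open>
  The algebras of the tower are subalgebras of one ambient algebra, the type \<^typ>\<open>'a\<close>; only their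
  elements matter, and the ambient algebra may be larger than their union. The base algebra \<open>B\<close> is
  \<open>A 0\<close>. The maps \<open>\<phi>\<^sub>0\<close> and \<open>\<phi> n\<close> (\<open>n \<ge> 1\<close>) are total functions of which only the restrictions to
  \<open>A 0\<close> and \<open>A n\<close> are relevant; \<open>\<phi> 0\<close> is not used.
\<close>

locale ncp_tower = complex_algebra scale
  for scale :: "complex \<Rightarrow> 'a::ring_1 \<Rightarrow> 'a" +
  fixes A :: "nat \<Rightarrow> 'a set" and \<phi>\<^sub>0 :: "'a \<Rightarrow> complex" and \<phi> :: "nat \<Rightarrow> 'a \<Rightarrow> 'a"
  assumes unital_subalgebra_A: "unital_subalgebra scale (A n)"
    and A_subset_Suc: "A n \<subseteq> A (Suc n)"
    and linear_phi0: "clinear_on scale (*) (A 0) \<phi>\<^sub>0"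
    and phi0_one: "\<phi>\<^sub>0 1 = 1"
    and cond_exp_phi: "conditional_expectation scale (A (Suc n)) (A n) (\<phi> (Suc n))"

text \<open>\<open>tower_E \<phi>\<^sub>0 \<phi> j\<close> is the composition \<open>\<phi>\<^sub>0 \<circ> \<phi> 1 \<circ> \<dots> \<circ> \<phi> j\<close>.\<close>

primrec tower_E :: "('a \<Rightarrow> complex) \<Rightarrow> (nat \<Rightarrow> 'a \<Rightarrow> 'a) \<Rightarrow> nat \<Rightarrow> 'a \<Rightarrow> complex" where
  "tower_E \<phi>\<^sub>0 \<phi> 0 = \<phi>\<^sub>0"
| "tower_E \<phi>\<^sub>0 \<phi> (Suc j) = tower_E \<phi>\<^sub>0 \<phi> j \<circ> \<phi> (Suc j)"

definition tower_E_inf ::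
    "(nat \<Rightarrow> 'a set) \<Rightarrow> ('a \<Rightarrow> complex) \<Rightarrow> (nat \<Rightarrow> 'a \<Rightarrow> 'a) \<Rightarrow> 'a \<Rightarrow> complex"
  where "tower_E_inf A \<phi>\<^sub>0 \<phi> x = (THE c. \<exists>j. x \<in> A j \<and> c = tower_E \<phi>\<^sub>0 \<phi> j x)"

lemma (in ncp_tower) A_mono: "i \<le> j \<Longrightarrow> A i \<subseteq> A j"
  using lift_Suc_mono_le[of A] A_subset_Suc by blast

lemma (in ncp_tower) tower_E_eq:
  assumes "x \<in> A i" "i \<le> j"
  shows "tower_E \<phi>\<^sub>0 \<phi> j x = tower_E \<phi>\<^sub>0 \<phi> i x"
  using assms(2)
proof (induction j rule: dec_induct)
  case (step n)
  have "x \<in> A n" using A_mono[OF step(1)] assms(1) by blast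
  then have "\<phi> (Suc n) x = x"
    using cond_exp_phi[of n] by (simp add: conditional_expectation_def)
  then show ?case using step by simp
qed simp

lemma (in ncp_tower) tower_E_inf_eq:
  assumes "x \<in> A j"
  shows "tower_E_inf A \<phi>\<^sub>0 \<phi> x = tower_E \<phi>\<^sub>0 \<phi> j x"
  unfolding tower_E_inf_def
proof (rule the_equality)
  show "\<exists>i. x \<in> A i \<and> tower_E \<phi>\<^sub>0 \<phi> j x = tower_E \<phi>\<^sub>0 \<phi> i x" using assms by blast
next
  fix c assume "\<exists>i. x \<in> A i \<and> c = tower_E \<phi>\<^sub>0 \<phi> i x"
  then obtain i where "x \<in> A i" "c = tower_E \<phi>\<^sub>0 \<phi> i x" by blast
  then show "c = tower_E \<phi>\<^sub>0 \<phi> j x"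
    using tower_E_eq[of x i j] tower_E_eq[of x j i] assms by (metis nle_le)
qed


subsection \<open>Noncrossing partitions\<close>

definition noncrossing :: "nat set set \<Rightarrow> bool"
  where "noncrossing \<pi> \<longleftrightarrow>
    \<not> (\<exists>V\<in>\<pi>. \<exists>W\<in>\<pi>. V \<noteq> W \<and>
        (\<exists>a b c d. a < b \<and> b < c \<and> c < d \<and> a \<in> V \<and> c \<in> V \<and> b \<in> W \<and> d \<in> W))"

definition NC :: "nat \<Rightarrow> nat set set set"
  where "NC n = {\<pi>. partition_on {1..n} \<pi> \<and> noncrossing \<pi>}"

lemma finite_NC: "finite (NC n)"
  by (rule finite_subset[OF _ finitely_many_partition_on[of "{1..n}"]]) (auto simp: NC_def)

text \<open>The Moebius function of the lattice \<open>(NC n, refines {1..n})\<close>; it is \<open>0\<close> on pairs that are not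
  comparable, because the sum is then empty.\<close>

function NC_mobius :: "nat \<Rightarrow> nat set set \<Rightarrow> nat set set \<Rightarrow> int" where
  "NC_mobius n \<pi> \<sigma> =
    (if \<pi> \<in> NC n \<and> \<sigma> \<in> NC n then
       if \<pi> = \<sigma> then 1
       else - (\<Sum>\<rho>\<in>{\<rho> \<in> NC n. refines {1..n} \<pi> \<rho> \<and> refines {1..n} \<rho> \<sigma> \<and> \<rho> \<noteq> \<sigma>}. NC_mobius n \<pi> \<rho>)
     else 0)"
  by pat_completeness auto
termination
proof (relation "measure (\<lambda>(n, \<pi>, \<sigma>). card {\<rho> \<in> NC n. refines {1..n} \<rho> \<sigma>})")
  fix n \<pi> \<sigma> \<rho>
  assume "\<pi> \<in> NC n \<and> \<sigma> \<in> NC n"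
    and \<rho>: "\<rho> \<in> {\<rho> \<in> NC n. refines {1..n} \<pi> \<rho> \<and> refines {1..n} \<rho> \<sigma> \<and> \<rho> \<noteq> \<sigma>}"
  then have \<sigma>: "\<sigma> \<in> NC n" "refines {1..n} \<sigma> \<sigma>" by (auto simp: NC_def refines_refl)
  have "{\<tau> \<in> NC n. refines {1..n} \<tau> \<rho>} \<subset> {\<tau> \<in> NC n. refines {1..n} \<tau> \<sigma>}"
    using \<rho> \<sigma> by (auto intro: refines_trans dest: refines_asym)
  then show "((n, \<pi>, \<rho>), (n, \<pi>, \<sigma>)) \<in> measure (\<lambda>(n, \<pi>, \<sigma>). card {\<rho> \<in> NC n. refines {1..n} \<rho> \<sigma>})"
    by (simp add: psubset_card_mono finite_NC)
qed simp

declare NC_mobius.simps [simp del]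

lemma sum_NC_mobius:
  assumes "\<pi> \<in> NC n" "\<sigma> \<in> NC n" "refines {1..n} \<pi> \<sigma>"
  shows "(\<Sum>\<rho>\<in>{\<rho> \<in> NC n. refines {1..n} \<pi> \<rho> \<and> refines {1..n} \<rho> \<sigma>}. NC_mobius n \<pi> \<rho>)
           = (if \<pi> = \<sigma> then 1 else 0)"
proof -
  let ?I = "{\<rho> \<in> NC n. refines {1..n} \<pi> \<rho> \<and> refines {1..n} \<rho> \<sigma>}"
  let ?J = "{\<rho> \<in> NC n. refines {1..n} \<pi> \<rho> \<and> refines {1..n} \<rho> \<sigma> \<and> \<rho> \<noteq> \<sigma>}"
  have I: "?I = insert \<sigma> ?J" using assms by (auto simp: NC_def refines_refl)
  have J: "?J = {}" if "\<pi> = \<sigma>" using that by (blast dest: refines_asym)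
  have S: "(\<Sum>\<rho>\<in>?I. NC_mobius n \<pi> \<rho>) = NC_mobius n \<pi> \<sigma> + (\<Sum>\<rho>\<in>?J. NC_mobius n \<pi> \<rho>)"
    unfolding I by (subst sum.insert) (auto simp: finite_NC)
  have M: "NC_mobius n \<pi> \<sigma> = (if \<pi> = \<sigma> then 1 else - (\<Sum>\<rho>\<in>?J. NC_mobius n \<pi> \<rho>))"
    using assms by (subst NC_mobius.simps) (simp only: simp_thms if_True)
  show ?thesis
  proof (cases "\<pi> = \<sigma>")
    case True
    then show ?thesis unfolding S M using J by (simp only: sum.empty) simp
  next
    case False
    then show ?thesis unfolding S M by simp
  qed
qed

text \<open>The points \<open>i\<close> and \<open>i\<close>-bar of \<open>1 < 1\<close>-bar \<open>< \<dots> < n < n\<close>-bar are encoded as \<open>2 * i - 1\<close> and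
  \<open>2 * i\<close>. The Kreweras complement of \<open>\<pi>\<close> is the largest noncrossing partition of the barred points
  whose union with \<open>\<pi>\<close> is noncrossing.\<close>

definition interlace :: "nat set set \<Rightarrow> nat set set \<Rightarrow> nat set set"
  where "interlace \<pi> \<sigma> = (\<lambda>V. (\<lambda>i. 2 * i - 1) ` V) ` \<pi> \<union> (\<lambda>W. (\<lambda>i. 2 * i) ` W) ` \<sigma>"

definition Kr :: "nat \<Rightarrow> nat set set \<Rightarrow> nat set set"
  where "Kr n \<pi> = (THE \<sigma>. \<sigma> \<in> NC n \<and> noncrossing (interlace \<pi> \<sigma>) \<and>
    (\<forall>\<tau>\<in>NC n. noncrossing (interlace \<pi> \<tau>) \<longrightarrow> refines {1..n} \<tau> \<sigma>))"


subsection \<open>Cumulants and R-transforms\<close>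

text \<open>For \<open>V = {v\<^sub>1 < \<dots> < v\<^sub>p}\<close>, the list of the entries of \<open>w\<close> at the positions \<open>v\<^sub>1, \<dots>, v\<^sub>p\<close>, where
  positions are counted from \<open>1\<close>.\<close>

definition subword :: "'b list \<Rightarrow> nat set \<Rightarrow> 'b list"
  where "subword w V = nths w {i. Suc i \<in> V}"

definition cumulant :: "('a::ring_1 \<Rightarrow> complex) \<Rightarrow> 'a list \<Rightarrow> complex"
  where "cumulant E as =
    (\<Sum>\<pi>\<in>NC (length as).
       (\<Prod>V\<in>\<pi>. E (prod_list (subword as V))) * of_int (NC_mobius (length as) \<pi> {{1..length as}}))"

text \<open>A formal power series in noncommuting indeterminates \<open>z\<^sub>1, z\<^sub>2, \<dots>\<close> is the function mapping the
  word \<open>[i\<^sub>1, \<dots>, i\<^sub>n]\<close> to the coefficient of \<open>z\<^bsub>i\<^sub>1\<^esub> \<cdots> z\<^bsub>i\<^sub>n\<^esub>\<close>; the empty word carries the constant term.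
  Series are added pointwise. A series in \<open>z\<^sub>1, \<dots>, z\<^sub>s\<close> vanishes on words with letters outside
  \<open>{1..s}\<close>.\<close>

type_synonym nc_series = "nat list \<Rightarrow> complex"

text \<open>The R-transform of \<open>a 1, \<dots>, a s\<close>.\<close>

definition R_transform :: "('a::ring_1 \<Rightarrow> complex) \<Rightarrow> nat \<Rightarrow> (nat \<Rightarrow> 'a) \<Rightarrow> nc_series"
  where "R_transform E s a w =
    (if w \<noteq> [] \<and> set w \<subseteq> {1..s} then cumulant E (map a w) else 0)"

text \<open>The series \<open>f(z\<^bsub>s+1\<^esub>, z\<^bsub>s+2\<^esub>, \<dots>)\<close>, i.e. \<open>f\<close> with each \<open>z\<^sub>i\<close> replaced by \<open>z\<^bsub>s+i\<^esub>\<close>.\<close>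

definition shift_vars :: "nat \<Rightarrow> nc_series \<Rightarrow> nc_series"
  where "shift_vars s f w = (if \<forall>i\<in>set w. s < i then f (map (\<lambda>i. i - s) w) else 0)"

definition boxed_convolution :: "nc_series \<Rightarrow> nc_series \<Rightarrow> nc_series"
  where "boxed_convolution f g w =
    (if w = [] then 0
     else \<Sum>\<pi>\<in>NC (length w).
            (\<Prod>V\<in>\<pi>. f (subword w V)) * (\<Prod>W\<in>Kr (length w) \<pi>. g (subword w W)))"


subsection \<open>Freeness\<close>

text \<open>Vanishing of mixed cumulants. Each entry carries a label (\<open>\<epsilon> i\<close>: taken from the algebra of \<open>X\<close>,
  otherwise from that of \<open>Y\<close>), and a list is mixed if both labels occur. The labels matter only if
  the two algebras share more than the scalars: an element of both may then be counted on either
  side, as in Voiculescu's definition of freeness. If mixedness were read off from membership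
  alone, the condition would be void for \<open>X = Y\<close>.\<close>

definition free_in ::
    "(complex \<Rightarrow> 'a::ring_1 \<Rightarrow> 'a) \<Rightarrow> 'a set \<Rightarrow> ('a \<Rightarrow> complex) \<Rightarrow> 'a set \<Rightarrow> 'a set \<Rightarrow> bool"
  where "free_in scale A E X Y \<longleftrightarrow> X \<subseteq> A \<and> Y \<subseteq> A \<and>
    (\<forall>as \<epsilon>. (\<forall>i<length as. as ! i \<in> (if \<epsilon> i then unital_subalgebra scale hull X
                                        else unital_subalgebra scale hull Y))
        \<and> (\<exists>i<length as. \<epsilon> i) \<and> (\<exists>i<length as. \<not> \<epsilon> i)
      \<longrightarrow> cumulant E as = 0)"

end

(* By Moebius inversion the cumulants are the unique solution of the moment-cumulant relation
     E(a_1 ... a_n) = sum over sigma in NC(n) of the products of cumulants over the blocks of sigma.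
   With mixed cumulants vanishing, (1) is immediate and (2) is multilinearity. For (3), the relation
   applied to x_1 y_1 ... x_n y_n leaves the pairs (pi, sigma) for which the union of pi on the odd
   points and sigma on the even points is noncrossing. For fixed pi, the map sending sigma to the
   join of pi and sigma is a bijection from these sigma onto the noncrossing rho above pi; its
   inverse takes the Kreweras complement of pi inside each block of rho. Hence the moments of the
   x_i y_i solve the moment-cumulant relation with the boxed convolution in the place of the
   cumulants. *)

theory Submission
  imports Defs "HOL-Library.FuncSet"
begin

subsection \<open>Subwords\<close>

text \<open>The complement has to be taken inside a block of \<open>\<rho>\<close>, that is, inside
  a set of positions with gaps, whereas \<open>Kr\<close> lives on \<open>{1..n}\<close> and is
  given only by a maximality property. The way out is a description by order alone: two barred
  points belong to the same block of the complement iff no block of \<open>\<pi>\<close> has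
  elements both inside and outside the interval between them. This makes sense on every set of
  positions, commutes with strictly monotone relabelling, and turns noncrossing of the union into a
  condition on pairs of points. Two properties of the complement then carry the bijection: together
  with \<open>\<pi>\<close> it connects all points, and it is the only compatible noncrossing
  partition that does so. Both are applied inside each block of \<open>\<rho>\<close>. Uniqueness in
  the moment-cumulant relation hides a change of side: the recursion for \<open>NC_mobius\<close>
  sums over the upper argument, while \<open>cumulant\<close> sums over the lower one, so a left
  inverse of the zeta function must be shown to be a right inverse.\<close>

definition enum :: "nat set \<Rightarrow> nat \<Rightarrow> nat"
  where "enum V i = sorted_list_of_set V ! (i - 1)"

lemma subword_eq_filter:
  "subword w V = map (\<lambda>i. w ! (i - 1)) (filter (\<lambda>i. i \<in> V) [1..<Suc (length w)])"
proof -
  have z: "zip w [0..<length w] = map (\<lambda>i. (w ! i, i)) [0..<length w]"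
    by (rule nth_equalityI) auto
  have u: "[1..<Suc (length w)] = map Suc [0..<length w]"
    by (simp add: map_Suc_upt)
  show ?thesis unfolding subword_def nths_def z u filter_map map_map by (simp add: o_def)
qed

lemma subword_eq_map:
  assumes "V \<subseteq> {1..length w}"
  shows "subword w V = map (\<lambda>i. w ! (i - 1)) (sorted_list_of_set V)"
proof -
  have "filter (\<lambda>i. i \<in> V) [1..<Suc (length w)] = sorted_list_of_set V"
  proof (rule sorted_distinct_set_unique)
    show "sorted (filter (\<lambda>i. i \<in> V) [1..<Suc (length w)])"
      by (rule sorted_wrt_filter[OF sorted_upt])
    show "set (filter (\<lambda>i. i \<in> V) [1..<Suc (length w)]) = set (sorted_list_of_set V)"
      using assms finite_subset[OF assms] by auto
  qed auto
  then show ?thesis unfolding subword_eq_filter by simp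
qed

lemma length_subword: "V \<subseteq> {1..length w} \<Longrightarrow> length (subword w V) = card V"
  by (simp add: subword_eq_map)

lemma subword_full [simp]: "subword w {Suc 0..length w} = w"
  unfolding subword_def by (rule nths_all) auto

lemma subword_map: "subword (map f w) V = map f (subword w V)"
  unfolding subword_def by (rule nths_map)

lemma set_subword_subset: "set (subword w V) \<subseteq> set w"
  unfolding subword_def by (rule set_nths_subset)

lemma set_subword: "V \<subseteq> {1..length w} \<Longrightarrow> set (subword w V) = (\<lambda>i. w ! (i - 1)) ` V"
  using finite_subset[of V "{1..length w}"] by (simp add: subword_eq_map)

lemma subword_Nil_iff: "V \<subseteq> {1..length w} \<Longrightarrow> subword w V = [] \<longleftrightarrow> V = {}"
  using set_subword[of V w] by (metis image_is_empty set_empty)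

lemma strict_mono_on_enum: "strict_mono_on {1..card V} (enum V)"
proof (rule strict_mono_onI)
  fix r s assume "r \<in> {1..card V}" "s \<in> {1..card V}" "r < s"
  then show "enum V r < enum V s"
    using strict_sorted_list_of_set[of V] sorted_wrt_nth_less[of "(<)" "sorted_list_of_set V" "r - 1" "s - 1"]
    by (auto simp: enum_def)
qed

lemma enum_image:
  assumes "finite V"
  shows "enum V ` {1..card V} = V"
proof -
  have "enum V ` {1..card V} = (!) (sorted_list_of_set V) ` {..<card V}"
    unfolding enum_def image_Suc_lessThan[symmetric] image_image by simp
  also have "\<dots> = V"
    using assms by (metis length_sorted_list_of_set lessThan_atLeast0 list.set_map map_nth set_sorted_list_of_set set_upt)
  finally show ?thesis .
qed

lemma sorted_list_of_set_image:
  fixes e :: "nat \<Rightarrow> nat"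
  assumes "finite U" "strict_mono_on U e"
  shows "sorted_list_of_set (e ` U) = map e (sorted_list_of_set U)"
proof (rule sorted_distinct_set_unique)
  have "sorted_wrt (\<lambda>i j. e i < e j) (sorted_list_of_set U)"
    by (rule sorted_wrt_mono_rel[OF _ strict_sorted_list_of_set[of U]])
      (use assms in \<open>auto dest: strict_mono_onD\<close>)
  then have "sorted_wrt (<) (map e (sorted_list_of_set U))"
    by (simp add: sorted_wrt_map)
  then show "sorted (map e (sorted_list_of_set U))" "distinct (map e (sorted_list_of_set U))"
    by (auto simp: strict_sorted_iff)
qed (use assms in auto)

text \<open>Nested subwords are read off from the original word. Partitions of
  \<open>{1..card V}\<close> can thus be exchanged for partitions of \<open>V\<close> itself, and
  everything is indexed by sets of positions in one fixed word.\<close>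

lemma subword_subword:
  assumes V: "V \<subseteq> {1..length w}" and U: "U \<subseteq> {1..card V}"
  shows "subword (subword w V) U = subword w (enum V ` U)"
proof -
  have fin: "finite V" "finite U" using V U finite_subset by blast+
  have "enum V ` U \<subseteq> {1..length w}" using enum_image[OF fin(1)] U V by blast
  then have "subword w (enum V ` U) = map (\<lambda>i. w ! (i - 1)) (map (enum V) (sorted_list_of_set U))"
    using sorted_list_of_set_image[OF fin(2) monotone_on_subset[OF strict_mono_on_enum U]]
    by (simp add: subword_eq_map)
  moreover have "subword (subword w V) U = map (\<lambda>i. subword w V ! (i - 1)) (sorted_list_of_set U)"
    using U V by (simp add: subword_eq_map length_subword)
  moreover have "subword w V ! (i - 1) = w ! (enum V i - 1)" if "i \<in> U" for i
    using that U subsetD[OF U that] by (auto simp: subword_eq_map[OF V] enum_def)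
  ultimately show ?thesis using fin by simp
qed


subsection \<open>Noncrossing partitions of finite sets\<close>

text \<open>The blocks of a noncrossing partition are partitioned in turn, hence the need for sets
  of positions with gaps.\<close>

definition NC_on :: "nat set \<Rightarrow> nat set set set"
  where "NC_on S = {\<pi>. partition_on S \<pi> \<and> noncrossing \<pi>}"

lemma NC_eq_NC_on: "NC n = NC_on {1..n}"
  by (simp add: NC_def NC_on_def)

lemma finite_NC_on: "finite S \<Longrightarrow> finite (NC_on S)"
  by (rule finite_subset[OF _ finitely_many_partition_on[of S]]) (auto simp: NC_on_def)

lemma NC_onD:
  assumes "\<pi> \<in> NC_on S"
  shows "partition_on S \<pi>" "noncrossing \<pi>" "\<And>V. V \<in> \<pi> \<Longrightarrow> V \<subseteq> S" "\<And>V. V \<in> \<pi> \<Longrightarrow> V \<noteq> {}"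
  using assms by (auto simp: NC_on_def partition_on_def)

lemma partition_on_same_block:
  assumes "partition_on S \<pi>" "V \<in> \<pi>" "W \<in> \<pi>" "x \<in> V" "x \<in> W"
  shows "V = W"
  using assms unfolding partition_on_def disjoint_def by blast

lemma noncrossingD:
  assumes "noncrossing \<pi>" "V \<in> \<pi>" "W \<in> \<pi>" "a < b" "b < c" "c < d" "a \<in> V" "c \<in> V" "b \<in> W" "d \<in> W"
  shows "V = W"
proof (rule ccontr)
  assume "V \<noteq> W"
  then have "\<exists>V\<in>\<pi>. \<exists>W\<in>\<pi>. V \<noteq> W \<and>
      (\<exists>a b c d. a < b \<and> b < c \<and> c < d \<and> a \<in> V \<and> c \<in> V \<and> b \<in> W \<and> d \<in> W)"
    using assms by (intro bexI[of _ V] bexI[of _ W] conjI exI[of _ a] exI[of _ b] exI[of _ c] exI[of _ d])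
  then show False using assms(1) unfolding noncrossing_def by contradiction
qed

lemma noncrossing_image:
  fixes e :: "nat \<Rightarrow> nat"
  assumes e: "strict_mono_on S e" and \<pi>: "\<Union>\<pi> \<subseteq> S"
  shows "noncrossing ((`) e ` \<pi>) \<longleftrightarrow> noncrossing \<pi>"
proof
  have less: "e a < e b \<longleftrightarrow> a < b" if "a \<in> S" "b \<in> S" for a b
    using strict_mono_onD[OF e] that by (cases a b rule: linorder_cases) (auto dest: less_asym)
  have inj: "V = W" if "V \<in> \<pi>" "W \<in> \<pi>" "e ` V = e ` W" for V W
  proof -
    have "V \<subseteq> S" "W \<subseteq> S" using that \<pi> by auto
    then show ?thesis using that inj_on_image_eq_iff[OF strict_mono_on_imp_inj_on[OF e], of V W] by simp
  qed
  show "noncrossing \<pi>" if n: "noncrossing ((`) e ` \<pi>)"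
    unfolding noncrossing_def
  proof clarify
    fix V W a b c d
    assume *: "V \<in> \<pi>" "W \<in> \<pi>" "V \<noteq> W" "a < b" "b < c" "c < d" "a \<in> V" "c \<in> V" "b \<in> W" "d \<in> W"
    then have S: "a \<in> S" "b \<in> S" "c \<in> S" "d \<in> S" using \<pi> by auto
    have "e ` V = e ` W"
      by (rule noncrossingD[OF n, of _ _ "e a" "e b" "e c" "e d"]) (use * S less in auto)
    then show False using inj * by blast
  qed
  show "noncrossing ((`) e ` \<pi>)" if n: "noncrossing \<pi>"
    unfolding noncrossing_def
  proof (clarsimp)
    fix V W a b c d
    assume *: "V \<in> \<pi>" "W \<in> \<pi>" "e ` V \<noteq> e ` W" "e a < e b" "e b < e c" "e c < e d"
      "a \<in> V" "c \<in> V" "b \<in> W" "d \<in> W"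
    then have S: "a \<in> S" "b \<in> S" "c \<in> S" "d \<in> S" using \<pi> by auto
    have "V = W"
      by (rule noncrossingD[OF n, of _ _ a b c d]) (use * S less in auto)
    then show False using * by blast
  qed
qed

lemma partition_on_image:
  assumes "partition_on S \<pi>" "inj_on e S"
  shows "partition_on (e ` S) ((`) e ` \<pi>)"
proof -
  have "(`) e ` \<pi> - {{}} = (`) e ` \<pi>" using assms by (auto simp: partition_on_def)
  then show ?thesis using partition_on_inj_image[OF assms] by simp
qed

lemma image_NC_on:
  fixes e :: "nat \<Rightarrow> nat"
  assumes "strict_mono_on S e" "\<pi> \<in> NC_on S"
  shows "(`) e ` \<pi> \<in> NC_on (e ` S)"
  using assms noncrossing_image[of S e \<pi>] partition_on_image[OF _ strict_mono_on_imp_inj_on, of S \<pi> e]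
  by (auto simp: NC_on_def partition_on_def)

lemma bij_betw_NC_on_image:
  fixes e :: "nat \<Rightarrow> nat"
  assumes e: "strict_mono_on S e"
  shows "bij_betw (\<lambda>\<pi>. (`) e ` \<pi>) (NC_on S) (NC_on (e ` S))"
proof (rule bij_betw_byWitness[where f' = "\<lambda>\<pi>. (`) (inv_into S e) ` \<pi>"])
  have inj: "inj_on e S" by (rule strict_mono_on_imp_inj_on[OF e])
  have e': "strict_mono_on (e ` S) (inv_into S e)"
  proof (rule strict_mono_onI)
    fix r s assume "r \<in> e ` S" "s \<in> e ` S" "r < s"
    then show "inv_into S e r < inv_into S e s"
      using strict_mono_onD[OF e] inj by (auto simp: inv_into_f_f) (metis less_asym linorder_neqE_nat)
  qed
  have im: "inv_into S e ` e ` S = S" using inj by (auto simp: inv_into_f_f)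
  show "(\<lambda>\<pi>. (`) e ` \<pi>) ` NC_on S \<subseteq> NC_on (e ` S)" using image_NC_on[OF e] by blast
  show "(\<lambda>\<pi>. (`) (inv_into S e) ` \<pi>) ` NC_on (e ` S) \<subseteq> NC_on S"
    using image_NC_on[OF e'] im by auto
  show "\<forall>\<pi>\<in>NC_on S. (`) (inv_into S e) ` (`) e ` \<pi> = \<pi>"
  proof
    fix \<pi> assume \<pi>: "\<pi> \<in> NC_on S"
    have "inv_into S e ` e ` V = V" if "V \<in> \<pi>" for V
      using inv_into_image_cancel[OF inj] NC_onD(3)[OF \<pi> that] .
    then show "(`) (inv_into S e) ` (`) e ` \<pi> = \<pi>" by (force simp: image_image)
  qed
  show "\<forall>\<pi>\<in>NC_on (e ` S). (`) e ` (`) (inv_into S e) ` \<pi> = \<pi>"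
  proof
    fix \<pi> assume \<pi>: "\<pi> \<in> NC_on (e ` S)"
    have "e ` inv_into S e ` V = V" if "V \<in> \<pi>" for V
      using image_inv_into_cancel[OF refl] NC_onD(3)[OF \<pi> that] .
    then show "(`) e ` (`) (inv_into S e) ` \<pi> = \<pi>" by (force simp: image_image)
  qed
qed

lemma sum_NC_subword:
  assumes V: "V \<subseteq> {1..length w}"
  shows "(\<Sum>\<sigma>\<in>NC (card V). h ((`) (enum V) ` \<sigma>)) = (\<Sum>\<sigma>\<in>NC_on V. h \<sigma>)"
proof -
  have "finite V" using V finite_subset by blast
  from bij_betw_NC_on_image[OF strict_mono_on_enum[of V], unfolded enum_image[OF this]]
  show ?thesis unfolding NC_eq_NC_on by (rule sum.reindex_bij_betw)
qed

lemma prod_image_subword: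
  assumes V: "V \<subseteq> {1..length w}" and \<sigma>: "\<Union>\<sigma> \<subseteq> {1..card V}"
  shows "(\<Prod>U\<in>\<sigma>. f (subword (subword w V) U)) = (\<Prod>U\<in>(`) (enum V) ` \<sigma>. f (subword w U))"
proof -
  have "inj_on ((`) (enum V)) \<sigma>"
    using \<sigma> strict_mono_on_imp_inj_on[OF strict_mono_on_enum[of V]]
    by (meson Sup_le_iff inj_on_def inj_on_image_eq_iff)
  moreover have "subword (subword w V) U = subword w (enum V ` U)" if "U \<in> \<sigma>" for U
    using that \<sigma> by (intro subword_subword V) auto
  ultimately show ?thesis by (simp add: prod.reindex)
qed

lemma sum_NC_prod_subword:
  assumes V: "V \<subseteq> {1..length w}"
  shows "(\<Sum>\<sigma>\<in>NC (card V). \<Prod>U\<in>\<sigma>. f (subword (subword w V) U))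
       = (\<Sum>\<sigma>\<in>NC_on V. \<Prod>U\<in>\<sigma>. f (subword w U))"
proof -
  have "(\<Sum>\<sigma>\<in>NC (card V). \<Prod>U\<in>\<sigma>. f (subword (subword w V) U))
      = (\<Sum>\<sigma>\<in>NC (card V). \<Prod>U\<in>(`) (enum V) ` \<sigma>. f (subword w U))"
    by (intro sum.cong refl prod_image_subword V) (auto simp: NC_def partition_on_def)
  also have "\<dots> = (\<Sum>\<sigma>\<in>NC_on V. \<Prod>U\<in>\<sigma>. f (subword w U))"
    by (rule sum_NC_subword[OF V])
  finally show ?thesis .
qed

section \<open>Refinements of a noncrossing partition, block by block\<close>

definition blocks_in :: "nat set set \<Rightarrow> nat set \<Rightarrow> nat set set"
  where "blocks_in \<pi> V = {W \<in> \<pi>. W \<subseteq> V}"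

lemma blocks_in_NC_on:
  assumes "\<pi> \<in> NC_on S" "refines S \<pi> \<rho>" "V \<in> \<rho>"
  shows "blocks_in \<pi> V \<in> NC_on V"
  using refines_obtains_subset[OF assms(2,3)] assms(1)
  unfolding NC_on_def blocks_in_def noncrossing_def by auto

lemma Union_blocks_in:
  assumes "refines S \<pi> \<rho>"
  shows "(\<Union>V\<in>\<rho>. blocks_in \<pi> V) = \<pi>"
  using assms unfolding refines_def blocks_in_def by auto

lemma glue_partition:
  assumes \<rho>: "partition_on S \<rho>" and g: "\<And>V. V \<in> \<rho> \<Longrightarrow> partition_on V (g V)"
  shows "partition_on S (\<Union>V\<in>\<rho>. g V)"
proof (rule partition_onI)
  have "\<Union>(\<Union>V\<in>\<rho>. g V) = (\<Union>V\<in>\<rho>. \<Union>(g V))" by blast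
  also have "\<dots> = \<Union>\<rho>" using partition_onD1[OF g] by auto
  finally show "\<Union>(\<Union>V\<in>\<rho>. g V) = S" using partition_onD1[OF \<rho>] by simp
  show "{} \<notin> (\<Union>V\<in>\<rho>. g V)" using g by (auto simp: partition_on_def)
  fix p q assume pq: "p \<in> (\<Union>V\<in>\<rho>. g V)" "q \<in> (\<Union>V\<in>\<rho>. g V)" "p \<noteq> q"
  then obtain V W where VW: "V \<in> \<rho>" "W \<in> \<rho>" "p \<in> g V" "q \<in> g W" by blast
  show "disjnt p q"
  proof (rule ccontr)
    assume "\<not> disjnt p q"
    then obtain x where x: "x \<in> p" "x \<in> q" by (auto simp: disjnt_def)
    then have "x \<in> V" "x \<in> W" using g VW by (auto simp: partition_on_def)
    then have "V = W" using partition_on_same_block[OF \<rho>] VW by blast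
    then show False using partition_on_same_block[OF g[OF VW(1)]] VW x pq by blast
  qed
qed

lemma glue_refines:
  assumes "partition_on S \<rho>" "\<And>V. V \<in> \<rho> \<Longrightarrow> partition_on V (g V)"
  shows "refines S (\<Union>V\<in>\<rho>. g V) \<rho>"
  unfolding refines_def using glue_partition[OF assms] assms
  by (auto simp: partition_on_def)

text \<open>Crossing blocks \<open>P\<close> and \<open>Q\<close> lie in blocks \<open>V\<close> and
  \<open>W\<close> of \<open>\<rho>\<close>. If \<open>V\<close> and \<open>W\<close> differ, they
  cross as well; if they agree, the crossing already occurs in \<open>g V\<close>.\<close>

lemma glue_NC_on:
  assumes \<rho>: "\<rho> \<in> NC_on S" and g: "\<And>V. V \<in> \<rho> \<Longrightarrow> g V \<in> NC_on V"
  shows "(\<Union>V\<in>\<rho>. g V) \<in> NC_on S"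
proof -
  have "noncrossing (\<Union>V\<in>\<rho>. g V)"
    unfolding noncrossing_def
  proof clarify
    fix P Q V W a b c d
    assume *: "V \<in> \<rho>" "W \<in> \<rho>" "P \<in> g V" "Q \<in> g W" "P \<noteq> Q" "a < b" "b < c" "c < d"
      "a \<in> P" "c \<in> P" "b \<in> Q" "d \<in> Q"
    have "P \<subseteq> V" "Q \<subseteq> W" using * NC_onD(3)[OF g] by blast+
    then have VW: "V = W"
      by (intro noncrossingD[OF NC_onD(2)[OF \<rho>] *(1,2,6-8)]) (use *(9-12) in blast)+
    have "P = Q"
      by (rule noncrossingD[OF NC_onD(2)[OF g[OF *(1)]] *(3) _ *(6) *(7) *(8) *(9) *(10) *(11) *(12)])
        (use *(4) VW in simp)
    then show False using *(5) by contradiction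
  qed
  then show ?thesis using glue_partition[of S \<rho> g] NC_onD(1)[OF \<rho>] NC_onD(1)[OF g]
    by (simp add: NC_on_def)
qed

lemma blocks_in_glue:
  assumes \<rho>: "partition_on S \<rho>" and g: "\<And>V. V \<in> \<rho> \<Longrightarrow> partition_on V (g V)" and V: "V \<in> \<rho>"
  shows "blocks_in (\<Union>V\<in>\<rho>. g V) V = g V"
proof
  show "g V \<subseteq> blocks_in (\<Union>V\<in>\<rho>. g V) V"
    using V g[OF V] by (auto simp: blocks_in_def partition_on_def)
  show "blocks_in (\<Union>V\<in>\<rho>. g V) V \<subseteq> g V"
  proof
    fix P assume "P \<in> blocks_in (\<Union>V\<in>\<rho>. g V) V"
    then obtain W where W: "W \<in> \<rho>" "P \<in> g W" "P \<subseteq> V" by (auto simp: blocks_in_def)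
    then have "P \<noteq> {}" "P \<subseteq> W" using g[OF W(1)] by (auto simp: partition_on_def)
    then obtain x where "x \<in> P" "x \<in> W" by blast
    then have "V = W" using partition_on_same_block[OF \<rho> V W(1)] W by blast
    then show "P \<in> g V" using W by simp
  qed
qed

text \<open>The interval below \<open>\<rho>\<close> is the product of the lattices of its blocks:
  expanding the product chooses a noncrossing partition of every block, and gluing these choices
  yields each refinement of \<open>\<rho>\<close> exactly once.\<close>

lemma prod_sum_NC_on:
  fixes h :: "nat set \<Rightarrow> nat set set \<Rightarrow> 'b::comm_semiring_1"
  assumes S: "finite S" and \<rho>: "\<rho> \<in> NC_on S"
  shows "(\<Prod>V\<in>\<rho>. \<Sum>\<pi>\<in>NC_on V. h V \<pi>)
       = (\<Sum>\<pi> | \<pi> \<in> NC_on S \<and> refines S \<pi> \<rho>. \<Prod>V\<in>\<rho>. h V (blocks_in \<pi> V))"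
proof -
  have P: "partition_on S \<rho>" using NC_onD[OF \<rho>] by blast
  have fin: "finite \<rho>" "\<And>V. V \<in> \<rho> \<Longrightarrow> finite V"
    using S finite_elements[OF S P] NC_onD(3)[OF \<rho>] finite_subset by blast+
  have g: "partition_on V (g V)" if "g \<in> Pi\<^sub>E \<rho> NC_on" "V \<in> \<rho>" for g V
    using that NC_onD(1) by (auto simp: PiE_def Pi_def)
  have "(\<Prod>V\<in>\<rho>. \<Sum>\<pi>\<in>NC_on V. h V \<pi>) = (\<Sum>g\<in>Pi\<^sub>E \<rho> NC_on. \<Prod>V\<in>\<rho>. h V (g V))"
    using fin by (intro prod_sum_PiE) (auto simp: finite_NC_on)
  also have "\<dots> = (\<Sum>\<pi> | \<pi> \<in> NC_on S \<and> refines S \<pi> \<rho>. \<Prod>V\<in>\<rho>. h V (blocks_in \<pi> V))"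
  proof (rule sum.reindex_bij_witness[where i = "\<lambda>\<pi>. restrict (blocks_in \<pi>) \<rho>"
                                       and j = "\<lambda>g. \<Union>V\<in>\<rho>. g V"])
    fix g assume "g \<in> Pi\<^sub>E \<rho> NC_on"
    note gg = g[OF this]
    show "restrict (blocks_in (\<Union>V\<in>\<rho>. g V)) \<rho> = g"
      using blocks_in_glue[OF P gg] \<open>g \<in> _\<close>
      by (auto simp: PiE_def extensional_def restrict_def fun_eq_iff)
    show "(\<Union>V\<in>\<rho>. g V) \<in> {\<pi> \<in> NC_on S. refines S \<pi> \<rho>}"
      using glue_NC_on[OF \<rho>, of g] glue_refines[OF P gg] \<open>g \<in> _\<close> by auto
    show "(\<Prod>V\<in>\<rho>. h V (blocks_in (\<Union>V\<in>\<rho>. g V) V)) = (\<Prod>V\<in>\<rho>. h V (g V))"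
      using blocks_in_glue[OF P gg] by simp
  next
    fix \<pi> assume \<pi>: "\<pi> \<in> {\<pi> \<in> NC_on S. refines S \<pi> \<rho>}"
    then show "restrict (blocks_in \<pi>) \<rho> \<in> Pi\<^sub>E \<rho> NC_on"
      using blocks_in_NC_on by auto
    show "(\<Union>V\<in>\<rho>. restrict (blocks_in \<pi>) \<rho> V) = \<pi>"
      using \<pi> Union_blocks_in[of S \<pi> \<rho>] by auto
  qed
  finally show ?thesis .
qed

lemma prod_Union_blocks:
  fixes f :: "nat set \<Rightarrow> 'b::comm_monoid_mult"
  assumes S: "finite S" and \<rho>: "partition_on S \<rho>" and g: "\<And>V. V \<in> \<rho> \<Longrightarrow> partition_on V (g V)"
  shows "(\<Prod>V\<in>\<rho>. \<Prod>W\<in>g V. f W) = (\<Prod>W\<in>(\<Union>V\<in>\<rho>. g V). f W)"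
proof (rule prod.UNION_disjoint[symmetric])
  show "finite \<rho>" by (rule finite_elements[OF S \<rho>])
  have "finite V" if "V \<in> \<rho>" for V using S \<rho> that by (auto simp: partition_on_def intro: finite_subset)
  then show "\<forall>V\<in>\<rho>. finite (g V)" using finite_elements[OF _ g] by blast
  show "\<forall>V\<in>\<rho>. \<forall>W\<in>\<rho>. V \<noteq> W \<longrightarrow> g V \<inter> g W = {}"
  proof (intro ballI impI equals0I)
    fix V W P assume *: "V \<in> \<rho>" "W \<in> \<rho>" "V \<noteq> W" "P \<in> g V \<inter> g W"
    then obtain x where "x \<in> P" "x \<in> V" "x \<in> W"
    proof -
      have "P \<noteq> {}" "P \<subseteq> V" "P \<subseteq> W"
        using g[OF *(1)] g[OF *(2)] *(4) by (auto simp: partition_on_def)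
      then show ?thesis using that by blast
    qed
    then show False using partition_on_same_block[OF \<rho>] * by blast
  qed
qed

lemma prod_blocks_in:
  fixes f :: "nat set \<Rightarrow> 'b::comm_monoid_mult"
  assumes S: "finite S" and r: "refines S \<pi> \<rho>"
  shows "(\<Prod>V\<in>\<rho>. \<Prod>W\<in>blocks_in \<pi> V. f W) = (\<Prod>W\<in>\<pi>. f W)"
proof -
  have "partition_on V (blocks_in \<pi> V)" if "V \<in> \<rho>" for V
    using refines_obtains_subset[OF r that] by (simp add: blocks_in_def)
  then show ?thesis
    using prod_Union_blocks[OF S, of \<rho> "blocks_in \<pi>" f] r Union_blocks_in[OF r]
    by (auto simp: refines_def)
qed

subsection \<open>Moments and cumulants\<close>

text \<open>In the incidence algebra the hypothesis \<open>left\<close> is m * zeta = delta and the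
  claim is zeta * m = delta. For h = zeta * m, associativity gives h * zeta = zeta, which is the
  fact \<open>one\<close>. As zeta is unitriangular, this determines h; the induction on the size of
  the down-set of \<open>v\<close> solves for it.\<close>

lemma mobius_right_inverse:
  fixes le :: "'p \<Rightarrow> 'p \<Rightarrow> bool" and m :: "'p \<Rightarrow> 'p \<Rightarrow> int"
  assumes P: "finite P"
    and lerefl: "\<And>x. x \<in> P \<Longrightarrow> le x x"
    and antisym: "\<And>x y. le x y \<Longrightarrow> le y x \<Longrightarrow> x = y"
    and trans: "\<And>x y z. le x y \<Longrightarrow> le y z \<Longrightarrow> le x z"
    and left: "\<And>x z. x \<in> P \<Longrightarrow> z \<in> P \<Longrightarrow> le x z \<Longrightarrow>
      (\<Sum>y | y \<in> P \<and> le x y \<and> le y z. m x y) = (if x = z then 1 else 0)"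
    and xz: "x \<in> P" "z \<in> P" "le x z"
  shows "(\<Sum>y | y \<in> P \<and> le x y \<and> le y z. m y z) = (if x = z then 1 else 0)"
proof -
  define h where "h w = (\<Sum>y | y \<in> P \<and> le x y \<and> le y w. m y w)" for w
  have one: "(\<Sum>w | w \<in> P \<and> le x w \<and> le w v. h w) = 1" if v: "v \<in> P" "le x v" for v
  proof -
    let ?Q = "{w \<in> P. le x w \<and> le w v}"
    have fin: "finite ?Q" using P by simp
    have "(\<Sum>w\<in>?Q. h w) = (\<Sum>w\<in>?Q. \<Sum>y | y \<in> ?Q \<and> le y w. m y w)"
      unfolding h_def by (intro sum.cong refl Collect_cong) (auto intro: trans)
    also have "\<dots> = (\<Sum>y\<in>?Q. \<Sum>w | w \<in> ?Q \<and> le y w. m y w)"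
      by (rule sum.swap_restrict[OF fin fin])
    also have "\<dots> = (\<Sum>y\<in>?Q. \<Sum>w | w \<in> P \<and> le y w \<and> le w v. m y w)"
      by (intro sum.cong refl Collect_cong) (auto intro: trans)
    also have "\<dots> = (\<Sum>y\<in>?Q. if y = v then 1 else 0)"
      using v by (intro sum.cong refl left) auto
    also have "\<dots> = 1" using v fin lerefl by (simp add: sum.delta)
    finally show ?thesis .
  qed
  have "h v = (if x = v then 1 else 0)" if "v \<in> P" "le x v" for v
    using that
  proof (induction "card {w \<in> P. le w v}" arbitrary: v rule: less_induct)
    case less
    let ?R = "{w \<in> P. le x w \<and> le w v \<and> w \<noteq> v}"
    have fin: "finite ?R" using P by simp
    have "{w \<in> P. le x w \<and> le w v} = insert v ?R" using less.prems lerefl by auto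
    then have "h v + (\<Sum>w\<in>?R. h w) = 1" using one[OF less.prems] fin by simp
    moreover have "h w = (if x = w then 1 else 0)" if "w \<in> ?R" for w
    proof (rule less.hyps)
      have "{u \<in> P. le u w} \<subset> {u \<in> P. le u v}"
        using that less.prems lerefl antisym trans by blast
      then show "card {u \<in> P. le u w} < card {u \<in> P. le u v}"
        using P by (intro psubset_card_mono) auto
    qed (use that in auto)
    then have "(\<Sum>w\<in>?R. h w) = (\<Sum>w\<in>?R. if x = w then 1 else 0)"
      by (rule sum.cong[OF refl])
    moreover have "(\<Sum>w\<in>?R. if x = w then 1 else 0) = (if x = v then 0 else (1 :: int))"
      using fin less.prems lerefl xz by (simp add: sum.delta')
    ultimately show ?case by (auto split: if_splits)
  qed
  from this[OF xz(2,3)] show ?thesis unfolding h_def .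
qed

lemma one_NC: "n \<noteq> 0 \<Longrightarrow> {{1..n}} \<in> NC n"
  by (auto simp: NC_def noncrossing_def partition_on_space)

lemma refines_one: "n \<noteq> 0 \<Longrightarrow> \<pi> \<in> NC n \<Longrightarrow> refines {1..n} \<pi> {{1..n}}"
  using one_NC[of n] by (auto simp: NC_def refines_def partition_on_def)

lemma sum_NC_mobius_one:
  assumes "\<sigma> \<in> NC n" "n \<noteq> 0"
  shows "(\<Sum>\<pi> | \<pi> \<in> NC n \<and> refines {1..n} \<sigma> \<pi>. NC_mobius n \<pi> {{1..n}})
    = (if \<sigma> = {{1..n}} then 1 else 0)"
proof -
  have "(\<Sum>\<pi> | \<pi> \<in> NC n \<and> refines {1..n} \<sigma> \<pi> \<and> refines {1..n} \<pi> {{1..n}}. NC_mobius n \<pi> {{1..n}})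
    = (if \<sigma> = {{1..n}} then 1 else 0)"
  proof (rule mobius_right_inverse[where le = "refines {1..n}"])
    show "refines {1..n} \<pi> \<pi>" if "\<pi> \<in> NC n" for \<pi>
      using that by (simp add: NC_def refines_refl)
    show "refines {1..n} \<sigma> {{1..n}}" by (rule refines_one[OF assms(2,1)])
  qed (fact finite_NC refines_asym refines_trans one_NC[OF assms(2)] sum_NC_mobius assms(1))+
  moreover have "{\<pi> \<in> NC n. refines {1..n} \<sigma> \<pi> \<and> refines {1..n} \<pi> {{1..n}}}
      = {\<pi> \<in> NC n. refines {1..n} \<sigma> \<pi>}"
    using refines_one[OF assms(2)] by blast
  ultimately show ?thesis by simp
qed

text \<open>Inserting the relation into every block of \<open>\<pi>\<close> makes the product of
  moments a sum of products of \<open>\<kappa>\<close> over all \<open>\<sigma>\<close> below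
  \<open>\<pi>\<close>. After an exchange of sums, \<open>\<sigma>\<close> carries the sum of the
  Moebius values over all \<open>\<pi>\<close> above it, which vanishes unless
  \<open>\<sigma>\<close> is the top. The relation is assumed for all nonempty subwords because the
  blocks of \<open>\<pi>\<close> call for it.\<close>

lemma cumulant_inversion:
  fixes m \<kappa> :: "'b list \<Rightarrow> complex"
  assumes w: "w \<noteq> []"
    and m: "\<And>V. V \<subseteq> {1..length w} \<Longrightarrow> V \<noteq> {} \<Longrightarrow>
      m (subword w V) = (\<Sum>\<sigma>\<in>NC (card V). \<Prod>U\<in>\<sigma>. \<kappa> (subword (subword w V) U))"
  shows "(\<Sum>\<pi>\<in>NC (length w). (\<Prod>V\<in>\<pi>. m (subword w V)) *
      of_int (NC_mobius (length w) \<pi> {{1..length w}})) = \<kappa> w"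
proof -
  let ?n = "length w"
  let ?\<mu> = "\<lambda>\<pi>. of_int (NC_mobius ?n \<pi> {{1..?n}}) :: complex"
  let ?K = "\<lambda>\<sigma>. \<Prod>U\<in>\<sigma>. \<kappa> (subword w U)"
  have n: "?n \<noteq> 0" using w by simp
  have "(\<Prod>V\<in>\<pi>. m (subword w V)) = (\<Sum>\<sigma> | \<sigma> \<in> NC ?n \<and> refines {1..?n} \<sigma> \<pi>. ?K \<sigma>)"
    if \<pi>: "\<pi> \<in> NC ?n" for \<pi>
  proof -
    have \<pi>': "\<pi> \<in> NC_on {1..?n}" using \<pi> by (simp add: NC_eq_NC_on)
    have "(\<Prod>V\<in>\<pi>. m (subword w V)) = (\<Prod>V\<in>\<pi>. \<Sum>\<sigma>\<in>NC_on V. ?K \<sigma>)"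
    proof (rule prod.cong[OF refl])
      fix V assume "V \<in> \<pi>"
      then have V: "V \<subseteq> {1..?n}" "V \<noteq> {}" using NC_onD(3,4)[OF \<pi>'] by auto
      show "m (subword w V) = (\<Sum>\<sigma>\<in>NC_on V. ?K \<sigma>)"
        unfolding m[OF V] by (rule sum_NC_prod_subword[OF V(1)])
    qed
    also have "\<dots> = (\<Sum>\<sigma> | \<sigma> \<in> NC_on {1..?n} \<and> refines {1..?n} \<sigma> \<pi>. \<Prod>V\<in>\<pi>. ?K (blocks_in \<sigma> V))"
      using \<pi>' by (intro prod_sum_NC_on) auto
    also have "\<dots> = (\<Sum>\<sigma> | \<sigma> \<in> NC ?n \<and> refines {1..?n} \<sigma> \<pi>. ?K \<sigma>)"
      unfolding NC_eq_NC_on by (intro sum.cong refl prod_blocks_in[of "{1..?n}"]) auto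
    finally show ?thesis .
  qed
  then have "(\<Sum>\<pi>\<in>NC ?n. (\<Prod>V\<in>\<pi>. m (subword w V)) * ?\<mu> \<pi>)
      = (\<Sum>\<pi>\<in>NC ?n. \<Sum>\<sigma> | \<sigma> \<in> NC ?n \<and> refines {1..?n} \<sigma> \<pi>. ?K \<sigma> * ?\<mu> \<pi>)"
    by (simp add: sum_distrib_right)
  also have "\<dots> = (\<Sum>\<sigma>\<in>NC ?n. \<Sum>\<pi> | \<pi> \<in> NC ?n \<and> refines {1..?n} \<sigma> \<pi>. ?K \<sigma> * ?\<mu> \<pi>)"
    by (rule sum.swap_restrict) (rule finite_NC)+
  also have "\<dots> = (\<Sum>\<sigma>\<in>NC ?n. ?K \<sigma> * of_int (if \<sigma> = {{1..?n}} then 1 else 0))"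
    by (intro sum.cong refl)
      (simp only: sum_distrib_left[symmetric] of_int_sum[symmetric] sum_NC_mobius_one[OF _ n])
  also have "\<dots> = (\<Sum>\<sigma>\<in>NC ?n. if \<sigma> = {{1..?n}} then ?K \<sigma> else 0)"
    by (intro sum.cong) auto
  also have "\<dots> = \<kappa> w"
    using one_NC[OF n] by (simp add: sum.delta finite_NC)
  finally show ?thesis .
qed

text \<open>The uniqueness criterion. Words are over an alphabet of indices and \<open>a\<close>
  inserts the elements, so that \<open>\<kappa>\<close> may be a function of indices, as the boxed
  convolution is.\<close>

lemma cumulant_eqI:
  assumes "w \<noteq> []"
    and "\<And>V. V \<subseteq> {1..length w} \<Longrightarrow> V \<noteq> {} \<Longrightarrow> E (prod_list (map a (subword w V)))
      = (\<Sum>\<sigma>\<in>NC (card V). \<Prod>U\<in>\<sigma>. \<kappa> (subword (subword w V) U))"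
  shows "cumulant E (map a w) = \<kappa> w"
  using cumulant_inversion[of w "\<lambda>v. E (prod_list (map a v))" \<kappa>] assms
  by (simp add: cumulant_def subword_map)

lemma card_block_less:
  assumes "\<sigma> \<in> NC n" "\<sigma> \<noteq> {{1..n}}" "U \<in> \<sigma>"
  shows "card U < n"
proof -
  have \<sigma>: "partition_on {1..n} \<sigma>" using assms by (simp add: NC_def)
  have "U \<noteq> {1..n}"
  proof
    assume U: "U = {1..n}"
    have "V = U" if "V \<in> \<sigma>" for V
    proof -
      have "V \<noteq> {}" "V \<subseteq> U" using \<sigma> that U by (auto simp: partition_on_def)
      then show ?thesis using partition_on_same_block[OF \<sigma> that assms(3)] by blast
    qed
    then have "\<sigma> = {U}" using assms(3) by blast
    then show False using assms U by simp
  qed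
  moreover have "U \<subseteq> {1..n}" using \<sigma> assms(3) by (auto simp: partition_on_def)
  ultimately have "card U < card {1..n}" by (intro psubset_card_mono) auto
  then show ?thesis by simp
qed

text \<open>The solution of the moment-cumulant relation by recursion on the length of the word; it
  coincides with the cumulant by uniqueness.\<close>

function solve_moments :: "('b list \<Rightarrow> complex) \<Rightarrow> 'b list \<Rightarrow> complex" where
  "solve_moments m w = m w -
    (\<Sum>\<sigma>\<in>{\<sigma> \<in> NC (length w). \<sigma> \<noteq> {{1..length w}}}. \<Prod>U\<in>\<sigma>. solve_moments m (subword w U))"
  by pat_completeness auto
termination
proof (relation "measure (\<lambda>(m, w). length w)")
  fix m :: "'b list \<Rightarrow> complex" and w :: "'b list" and \<sigma> U
  assume *: "\<sigma> \<in> {\<sigma> \<in> NC (length w). \<sigma> \<noteq> {{1..length w}}}" "U \<in> \<sigma>"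
  then have "U \<subseteq> {1..length w}" by (auto simp: NC_def partition_on_def)
  then show "((m, subword w U), (m, w)) \<in> measure (\<lambda>(m, w). length w)"
    using card_block_less[of \<sigma> "length w" U] * by (simp add: length_subword)
qed simp

declare solve_moments.simps [simp del]

lemma sum_solve_moments:
  assumes "w \<noteq> []"
  shows "(\<Sum>\<sigma>\<in>NC (length w). \<Prod>U\<in>\<sigma>. solve_moments m (subword w U)) = m w"
proof -
  let ?N = "{\<sigma> \<in> NC (length w). \<sigma> \<noteq> {{1..length w}}}"
  have N: "NC (length w) = insert {{1..length w}} ?N" "finite ?N"
    using one_NC[of "length w"] assms by (auto simp: finite_NC)
  have "(\<Sum>\<sigma>\<in>NC (length w). \<Prod>U\<in>\<sigma>. solve_moments m (subword w U))
      = solve_moments m w + (\<Sum>\<sigma>\<in>?N. \<Prod>U\<in>\<sigma>. solve_moments m (subword w U))"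
    by (subst N(1), subst sum.insert) (use N(2) in simp_all)
  then show ?thesis using solve_moments.simps[of m w] by simp
qed

text \<open>\<open>solve_moments\<close> satisfies the relation by construction, on subwords too, so
  uniqueness identifies it with the cumulant on every nonempty word, and the relation carries
  over.\<close>

lemma moment_cumulant:
  assumes "as \<noteq> []"
  shows "E (prod_list as) = (\<Sum>\<sigma>\<in>NC (length as). \<Prod>U\<in>\<sigma>. cumulant E (subword as U))"
proof -
  let ?m = "\<lambda>v. E (prod_list v)"
  have *: "cumulant E v = solve_moments ?m v" if "v \<noteq> []" for v
  proof -
    have "cumulant E (map (\<lambda>x. x) v) = solve_moments ?m v"
    proof (rule cumulant_eqI[OF that])
      fix V assume V: "V \<subseteq> {1..length v}" "V \<noteq> {}"
      then show "E (prod_list (map (\<lambda>x. x) (subword v V)))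
        = (\<Sum>\<sigma>\<in>NC (card V). \<Prod>U\<in>\<sigma>. solve_moments ?m (subword (subword v V) U))"
        using sum_solve_moments[of "subword v V" ?m] length_subword[OF V(1)] subword_Nil_iff[OF V(1)]
        by simp
    qed
    then show ?thesis by simp
  qed
  have "E (prod_list as) = (\<Sum>\<sigma>\<in>NC (length as). \<Prod>U\<in>\<sigma>. solve_moments ?m (subword as U))"
    using sum_solve_moments[OF assms, of ?m] by simp
  also have "\<dots> = (\<Sum>\<sigma>\<in>NC (length as). \<Prod>U\<in>\<sigma>. cumulant E (subword as U))"
  proof (intro sum.cong prod.cong refl)
    fix \<sigma> U assume "\<sigma> \<in> NC (length as)" "U \<in> \<sigma>"
    then have "U \<subseteq> {1..length as}" "U \<noteq> {}" using NC_onD(3,4) by (auto simp: NC_eq_NC_on)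
    then show "solve_moments ?m (subword as U) = cumulant E (subword as U)"
      using *[of "subword as U"] subword_Nil_iff by metis
  qed
  finally show ?thesis .
qed

subsection \<open>Kreweras complements and joins\<close>

text \<open>The barred points \<open>i\<close> and \<open>j\<close> are not separated by any block of \<open>\<pi>\<close>: for \<open>i < j\<close>, a block has
  either all or none of its elements in \<open>{i<..j}\<close>.\<close>

definition unseparated :: "nat set set \<Rightarrow> nat \<Rightarrow> nat \<Rightarrow> bool"
  where "unseparated \<pi> i j \<longleftrightarrow>
    (\<forall>P\<in>\<pi>. \<forall>a\<in>P. \<forall>b\<in>P. ((a \<le> i) = (a \<le> j)) = ((b \<le> i) = (b \<le> j)))"

text \<open>The union of \<open>\<pi>\<close> on the points and \<open>\<sigma>\<close> on the barred points is noncrossing, if \<open>\<pi>\<close> and \<open>\<sigma>\<close> are.\<close>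

definition compat :: "nat set set \<Rightarrow> nat set set \<Rightarrow> bool"
  where "compat \<pi> \<sigma> \<longleftrightarrow> (\<forall>W\<in>\<sigma>. \<forall>i\<in>W. \<forall>j\<in>W. unseparated \<pi> i j)"

text \<open>The Kreweras complement as classes of an equivalence relation, for an arbitrary set
  \<open>S\<close> of positions. It replaces \<open>Kr\<close> wherever a complement inside a block
  is needed.\<close>

definition compl_on :: "nat set \<Rightarrow> nat set set \<Rightarrow> nat set set"
  where "compl_on S \<pi> = (\<lambda>i. {j \<in> S. unseparated \<pi> i j}) ` S"

lemma unseparatedD:
  "unseparated \<pi> i j \<Longrightarrow> P \<in> \<pi> \<Longrightarrow> a \<in> P \<Longrightarrow> b \<in> P \<Longrightarrow>
    ((a \<le> i) = (a \<le> j)) = ((b \<le> i) = (b \<le> j))"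
  unfolding unseparated_def by blast

lemma unseparated_mono: "Q \<subseteq> \<pi> \<Longrightarrow> unseparated \<pi> i j \<Longrightarrow> unseparated Q i j"
  unfolding unseparated_def by (rule ballI) (drule (1) subsetD, drule (1) bspec, assumption)

lemma unseparated_refl [simp]: "unseparated \<pi> i i"
  unfolding unseparated_def by simp

lemma unseparated_sym: "unseparated \<pi> i j \<Longrightarrow> unseparated \<pi> j i"
  unfolding unseparated_def by (intro ballI) (drule bspec, assumption, drule bspec, assumption, drule bspec, assumption, argo)

lemma unseparated_trans:
  assumes "unseparated \<pi> i j" "unseparated \<pi> j k"
  shows "unseparated \<pi> i k"
  unfolding unseparated_def
proof (intro ballI)
  fix P a b assume P: "P \<in> \<pi>" "a \<in> P" "b \<in> P"
  show "((a \<le> i) = (a \<le> k)) = ((b \<le> i) = (b \<le> k))"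
    using unseparatedD[OF assms(1) P] unseparatedD[OF assms(2) P] by argo
qed

lemma partition_on_classes:
  assumes "\<And>i. i \<in> S \<Longrightarrow> R i i" "\<And>i j. R i j \<Longrightarrow> R j i" "\<And>i j k. R i j \<Longrightarrow> R j k \<Longrightarrow> R i k"
  shows "partition_on S ((\<lambda>i. {j \<in> S. R i j}) ` S)"
proof (rule partition_onI)
  fix p q assume pq: "p \<in> (\<lambda>i. {j \<in> S. R i j}) ` S" "q \<in> (\<lambda>i. {j \<in> S. R i j}) ` S" "p \<noteq> q"
  then obtain i j where ij: "p = {k \<in> S. R i k}" "q = {k \<in> S. R j k}" by blast
  show "disjnt p q"
  proof (rule ccontr)
    assume "\<not> disjnt p q"
    then obtain k where k: "R i k" "R j k" using ij by (auto simp: disjnt_def)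
    have "R i j" "R j i" using assms(3)[OF k(1) assms(2)[OF k(2)]] assms(2) by blast+
    then have "R i l \<longleftrightarrow> R j l" for l using assms(3)[of i j l] assms(3)[of j i l] by blast
    then show False using ij pq(3) by simp
  qed
next
  show "\<Union>((\<lambda>i. {j \<in> S. R i j}) ` S) = S" using assms(1) by blast
  show "{} \<notin> (\<lambda>i. {j \<in> S. R i j}) ` S" using assms(1) by blast
qed

lemma compl_on_partition: "partition_on S (compl_on S \<pi>)"
  unfolding compl_on_def
  by (rule partition_on_classes) (auto intro: unseparated_sym unseparated_trans)

lemma compl_on_same_block:
  "B \<in> compl_on S \<pi> \<Longrightarrow> i \<in> B \<Longrightarrow> j \<in> S \<Longrightarrow> j \<in> B \<longleftrightarrow> unseparated \<pi> i j"
  unfolding compl_on_def by (auto intro: unseparated_sym unseparated_trans)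

text \<open>Let a < b < c < d with a, c and b, d unseparated. Every block of \<open>\<pi>\<close> is
  contained in or disjoint from each of \<open>{a<..c}\<close> and \<open>{b<..d}\<close>, hence
  also their intersection \<open>{b<..c}\<close>. So b and c are unseparated and all four points
  share a class.\<close>

lemma compl_on_NC: "compl_on S \<pi> \<in> NC_on S"
proof -
  have "noncrossing (compl_on S \<pi>)"
    unfolding noncrossing_def
  proof clarify
    fix V W a b c d
    assume *: "V \<in> compl_on S \<pi>" "W \<in> compl_on S \<pi>" "V \<noteq> W" "a < b" "b < c" "c < d"
      "a \<in> V" "c \<in> V" "b \<in> W" "d \<in> W"
    have S: "V \<subseteq> S" "W \<subseteq> S" using * compl_on_partition[of S \<pi>] by (auto simp: partition_on_def)
    have ac: "unseparated \<pi> a c" using compl_on_same_block[OF *(1,7)] * S by blast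
    have bd: "unseparated \<pi> b d" using compl_on_same_block[OF *(2,9)] * S by blast
    have "unseparated \<pi> b c"
      unfolding unseparated_def
    proof (intro ballI)
      fix P x y assume P: "P \<in> \<pi>" "x \<in> P" "y \<in> P"
      show "((x \<le> b) = (x \<le> c)) = ((y \<le> b) = (y \<le> c))"
        using unseparatedD[OF ac P] unseparatedD[OF bd P] *(4-6) by linarith
    qed
    then have "c \<in> W" using compl_on_same_block[OF *(2,9)] * S by blast
    then show False using partition_on_same_block[OF compl_on_partition *(1,2)] * by blast
  qed
  then show ?thesis using compl_on_partition by (simp add: NC_on_def)
qed

lemma compat_compl_on: "compat \<pi> (compl_on S \<pi>)"
  unfolding compat_def compl_on_def by (auto intro: unseparated_sym unseparated_trans)

lemma refines_compl_on:
  assumes "partition_on S \<tau>" "compat \<pi> \<tau>"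
  shows "refines S \<tau> (compl_on S \<pi>)"
  unfolding refines_def
proof (intro conjI ballI assms(1) compl_on_partition)
  fix W assume W: "W \<in> \<tau>"
  then obtain i where i: "i \<in> W" using assms(1) by (fastforce simp: partition_on_def)
  have "W \<subseteq> S" using W assms(1) by (auto simp: partition_on_def)
  then have "W \<subseteq> {j \<in> S. unseparated \<pi> i j}" using W i assms(2) by (auto simp: compat_def)
  then show "\<exists>Y\<in>compl_on S \<pi>. W \<subseteq> Y" using i \<open>W \<subseteq> S\<close> by (auto simp: compl_on_def)
qed

text \<open>In the encoding, the point \<open>u\<close> precedes the barred point \<open>v\<close>
  iff \<open>u \<le> v\<close>, so the comparisons in \<open>unseparated\<close> express the order
  of points and barred points. A block of \<open>\<pi>\<close> with one element in
  \<open>{i<..j}\<close> and one outside is then exactly a block that crosses the barred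
  pair.\<close>

lemma compat_iff_noncrossing_interlace:
  assumes \<pi>: "\<pi> \<in> NC n" and \<sigma>: "\<sigma> \<in> NC n"
  shows "noncrossing (interlace \<pi> \<sigma>) \<longleftrightarrow> compat \<pi> \<sigma>"
proof
  assume nc: "noncrossing (interlace \<pi> \<sigma>)"
  \<comment> \<open>Positivity matters for the truncated subtraction: \<open>2 * a - 1\<close> would
    be even for \<open>a = 0\<close>.\<close>
  have pos: "0 < a" if "P \<in> \<pi>" "a \<in> P" for P a
    using that \<pi> by (force simp: NC_def partition_on_def)
  show "compat \<pi> \<sigma>"
    unfolding compat_def unseparated_def
  proof (intro ballI)
    fix W i j P a b
    assume *: "W \<in> \<sigma>" "i \<in> W" "j \<in> W" "P \<in> \<pi>" "a \<in> P" "b \<in> P"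
    let ?P = "(\<lambda>i. 2 * i - 1) ` P" and ?W = "(\<lambda>i. 2 * i) ` W"
    have PW: "?P \<in> interlace \<pi> \<sigma>" "?W \<in> interlace \<pi> \<sigma>"
      using * by (auto simp: interlace_def)
    have "odd (2 * a - 1)" using pos[of P a] * by simp
    then have ne: "?P \<noteq> ?W" using * by (metis (no_types, lifting) dvd_triv_left imageE imageI)
    have mem: "2 * a - 1 \<in> ?P" "2 * b - 1 \<in> ?P" "2 * i \<in> ?W" "2 * j \<in> ?W" using * by auto
    have sep: "2 * u - 1 < 2 * v \<longleftrightarrow> u \<le> v" "2 * v < 2 * u - 1 \<longleftrightarrow> v < u" if "u \<in> P" for u v :: nat
      using pos[OF *(4) that] by linarith+
    have X: False if "2 * c - 1 < 2 * k" "2 * k < 2 * d - 1" "2 * d - 1 < 2 * l"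
      "c \<in> P" "d \<in> P" "k \<in> W" "l \<in> W" for c d k l
      using noncrossingD[OF nc PW that(1-3)] that ne by blast
    have Y: False if "2 * k < 2 * c - 1" "2 * c - 1 < 2 * l" "2 * l < 2 * d - 1"
      "c \<in> P" "d \<in> P" "k \<in> W" "l \<in> W" for c d k l
      using noncrossingD[OF nc PW(2,1) that(1-3)] that ne by blast
    \<comment> \<open>The two alternations, starting with a point or with a barred point. Exchanging
      \<open>c\<close> with \<open>d\<close> and \<open>k\<close> with \<open>l\<close> covers every
      way in which exactly one of two points of \<open>P\<close> lies between the barred
      points.\<close>
    have X': "\<not> (c \<le> k \<and> \<not> d \<le> k \<and> d \<le> l) \<and> \<not> (\<not> c \<le> k \<and> c \<le> l \<and> \<not> d \<le> l)"
      if "c \<in> P" "d \<in> P" "k \<in> W" "l \<in> W" for c d k l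
      using X[of c k d l] Y[of k c l d] that sep[of c k] sep[of d k] sep[of c l] sep[of d l]
      by (meson not_le)
    show "((a \<le> i) = (a \<le> j)) = ((b \<le> i) = (b \<le> j))"
      using X'[OF *(5,6,2,3)] X'[OF *(6,5,2,3)] X'[OF *(5,6,3,2)] X'[OF *(6,5,3,2)] by argo
  qed
next
  assume c: "compat \<pi> \<sigma>"
  have sets: "V \<subseteq> {1..n}" if "V \<in> \<pi> \<or> V \<in> \<sigma>" for V
    using that \<pi> \<sigma> by (auto simp: NC_def partition_on_def)
  have A: False if "V \<in> \<pi>" "W \<in> \<sigma>" "p \<in> V" "q \<in> V" "i \<in> W" "j \<in> W"
    "2 * p - 1 < 2 * i \<and> 2 * i < 2 * q - 1 \<and> 2 * q - 1 < 2 * j \<or>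
     2 * i < 2 * p - 1 \<and> 2 * p - 1 < 2 * j \<and> 2 * j < 2 * q - 1" for V W p q i j
  proof -
    have "0 < p" "0 < q" using sets[of V] that by auto
    moreover have "unseparated \<pi> i j" using c that(2,5,6) by (auto simp: compat_def)
    then have "((p \<le> i) = (p \<le> j)) = ((q \<le> i) = (q \<le> j))" by (rule unseparatedD) fact+
    ultimately show False using that(7) by linarith
  qed
  have smono: "strict_mono_on {1..n} (\<lambda>i. 2 * i - 1 :: nat)" "strict_mono_on {1..n} (\<lambda>i. 2 * i :: nat)"
    by (auto intro!: strict_mono_onI)
  have N: "noncrossing ((`) (\<lambda>i. 2 * i - 1) ` \<pi>)" "noncrossing ((`) (\<lambda>i. 2 * i) ` \<sigma>)"
    using noncrossing_image[OF smono(1), of \<pi>] noncrossing_image[OF smono(2), of \<sigma>] \<pi> \<sigma>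
    by (auto simp: NC_def partition_on_def)
  show "noncrossing (interlace \<pi> \<sigma>)"
    unfolding noncrossing_def
  proof clarify
    fix V W a b c d
    assume *: "V \<in> interlace \<pi> \<sigma>" "W \<in> interlace \<pi> \<sigma>" "V \<noteq> W" "a < b" "b < c" "c < d"
      "a \<in> V" "c \<in> V" "b \<in> W" "d \<in> W"
    consider "V \<in> (`) (\<lambda>i. 2 * i - 1) ` \<pi>" "W \<in> (`) (\<lambda>i. 2 * i - 1) ` \<pi>"
      | "V \<in> (`) (\<lambda>i. 2 * i) ` \<sigma>" "W \<in> (`) (\<lambda>i. 2 * i) ` \<sigma>"
      | "V \<in> (`) (\<lambda>i. 2 * i - 1) ` \<pi>" "W \<in> (`) (\<lambda>i. 2 * i) ` \<sigma>"
      | "V \<in> (`) (\<lambda>i. 2 * i) ` \<sigma>" "W \<in> (`) (\<lambda>i. 2 * i - 1) ` \<pi>"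
      using *(1,2) unfolding interlace_def by blast
    then show False
    proof cases
      case 1
      then show ?thesis using noncrossingD[OF N(1) 1 *(4-10)] *(3) by simp
    next
      case 2
      then show ?thesis using noncrossingD[OF N(2) 2 *(4-10)] *(3) by simp
    next
      case 3
      then obtain V' W' where VW: "V' \<in> \<pi>" "V = (\<lambda>i. 2 * i - 1) ` V'" "W' \<in> \<sigma>" "W = (\<lambda>i. 2 * i) ` W'"
        by blast
      obtain p q i j where "p \<in> V'" "a = 2 * p - 1" "q \<in> V'" "c = 2 * q - 1" "i \<in> W'" "b = 2 * i"
        "j \<in> W'" "d = 2 * j" using *(7-10) VW by blast
      then show ?thesis using A[of V' W' p q i j] VW *(4-6) by blast
    next
      case 4
      then obtain V' W' where VW: "V' \<in> \<sigma>" "V = (\<lambda>i. 2 * i) ` V'" "W' \<in> \<pi>" "W = (\<lambda>i. 2 * i - 1) ` W'"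
        by blast
      obtain p q i j where "p \<in> W'" "b = 2 * p - 1" "q \<in> W'" "d = 2 * q - 1" "i \<in> V'" "a = 2 * i"
        "j \<in> V'" "c = 2 * j" using *(7-10) VW by blast
      then show ?thesis using A[of W' V' p q i j] VW *(4-6) by blast
    qed
  qed
qed

text \<open>The classes form a compatible noncrossing partition and every compatible one refines
  them, which is the defining maximality; antisymmetry of refinement settles the definite
  description.\<close>

lemma Kr_eq_compl_on:
  assumes "\<pi> \<in> NC n"
  shows "Kr n \<pi> = compl_on {1..n} \<pi>"
  unfolding Kr_def
proof (rule the_equality)
  let ?K = "compl_on {1..n} \<pi>"
  have K: "?K \<in> NC n" by (simp add: NC_eq_NC_on compl_on_NC)
  have ref: "refines {1..n} \<tau> ?K" if "\<tau> \<in> NC n" "noncrossing (interlace \<pi> \<tau>)" for \<tau>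
    using refines_compl_on[of "{1..n}" \<tau> \<pi>] compat_iff_noncrossing_interlace[OF assms that(1)] that
    by (simp add: NC_def)
  have nc: "noncrossing (interlace \<pi> ?K)"
    using compat_iff_noncrossing_interlace[OF assms K] compat_compl_on by blast
  show "?K \<in> NC n \<and> noncrossing (interlace \<pi> ?K) \<and>
    (\<forall>\<tau>\<in>NC n. noncrossing (interlace \<pi> \<tau>) \<longrightarrow> refines {1..n} \<tau> ?K)"
    using K ref nc by blast
  fix \<sigma> assume "\<sigma> \<in> NC n \<and> noncrossing (interlace \<pi> \<sigma>) \<and>
    (\<forall>\<tau>\<in>NC n. noncrossing (interlace \<pi> \<tau>) \<longrightarrow> refines {1..n} \<tau> \<sigma>)"
  then show "\<sigma> = ?K" using refines_asym[of "{1..n}" \<sigma> ?K] ref K nc by blast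
qed

lemma compl_on_image:
  fixes e :: "nat \<Rightarrow> nat"
  assumes e: "strict_mono_on S e" and \<pi>: "\<Union>\<pi> \<subseteq> S"
  shows "compl_on (e ` S) ((`) e ` \<pi>) = (`) e ` compl_on S \<pi>"
proof -
  have le: "e a \<le> e b \<longleftrightarrow> a \<le> b" if "a \<in> S" "b \<in> S" for a b
    using strict_mono_onD[OF e] that by (cases a b rule: linorder_cases) (auto dest: less_imp_le leD)
  have un: "unseparated ((`) e ` \<pi>) (e i) (e j) \<longleftrightarrow> unseparated \<pi> i j" if "i \<in> S" "j \<in> S" for i j
  proof -
    have "((e a \<le> e i) = (e a \<le> e j)) = ((e b \<le> e i) = (e b \<le> e j)) \<longleftrightarrow>
      ((a \<le> i) = (a \<le> j)) = ((b \<le> i) = (b \<le> j))" if "P \<in> \<pi>" "a \<in> P" "b \<in> P" for P a b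
    proof -
      have "a \<in> S" "b \<in> S" using that \<pi> by auto
      then show ?thesis using le \<open>i \<in> S\<close> \<open>j \<in> S\<close> by simp
    qed
    then show ?thesis unfolding unseparated_def by (auto simp del: not_le)
  qed
  have "{j \<in> e ` S. unseparated ((`) e ` \<pi>) (e i) j} = e ` {j \<in> S. unseparated \<pi> i j}" if "i \<in> S" for i
    using un[OF that] by auto
  then show ?thesis unfolding compl_on_def by (auto simp: image_image intro!: image_cong)
qed

section \<open>Joins, and the connectedness that characterises the complement\<close>

definition saturated :: "nat set set \<Rightarrow> nat set \<Rightarrow> bool"
  where "saturated Q T \<longleftrightarrow> (\<forall>P\<in>Q. P \<subseteq> T \<or> P \<inter> T = {})"

text \<open>The connected components of the sets in \<open>Q\<close>: two points are identified iff
  no saturated set tells them apart. For the union of two partitions this is their join among all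
  partitions. Saturated sets replace chains of overlapping blocks, so a single set suffices to show
  that two points are not connected.\<close>

definition join_on :: "nat set \<Rightarrow> nat set set \<Rightarrow> nat set set"
  where "join_on S Q = (\<lambda>x. {y \<in> S. \<forall>T. saturated Q T \<longrightarrow> (x \<in> T \<longleftrightarrow> y \<in> T)}) ` S"

lemma saturatedD: "saturated Q T \<Longrightarrow> P \<in> Q \<Longrightarrow> x \<in> P \<Longrightarrow> y \<in> P \<Longrightarrow> x \<in> T \<longleftrightarrow> y \<in> T"
  unfolding saturated_def by blast

lemma saturatedI: "(\<And>P x y. P \<in> Q \<Longrightarrow> x \<in> P \<Longrightarrow> y \<in> P \<Longrightarrow> x \<in> T \<Longrightarrow> y \<in> T) \<Longrightarrow> saturated Q T"
  unfolding saturated_def by blast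

lemma join_on_partition: "partition_on S (join_on S Q)"
  unfolding join_on_def by (rule partition_on_classes) auto

lemma join_on_same_block:
  "R \<in> join_on S Q \<Longrightarrow> x \<in> R \<Longrightarrow> y \<in> R \<Longrightarrow> saturated Q T \<Longrightarrow> x \<in> T \<longleftrightarrow> y \<in> T"
  unfolding join_on_def by auto

lemma block_subset_join_on:
  assumes "P \<in> Q" "P \<subseteq> S" "P \<noteq> {}"
  shows "\<exists>R\<in>join_on S Q. P \<subseteq> R"
proof -
  obtain x where x: "x \<in> P" using assms by blast
  have "P \<subseteq> {y \<in> S. \<forall>T. saturated Q T \<longrightarrow> (x \<in> T \<longleftrightarrow> y \<in> T)}"
    using assms saturatedD[OF _ assms(1) x] by blast
  moreover have "x \<in> S" using x assms by blast
  ultimately show ?thesis unfolding join_on_def by blast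
qed

lemma saturated_join_block:
  assumes "R \<in> join_on S Q" "\<And>P. P \<in> Q \<Longrightarrow> P \<subseteq> S" "{} \<notin> Q"
  shows "saturated Q R"
proof (rule saturatedI)
  fix P x y assume P: "P \<in> Q" "x \<in> P" "y \<in> P" "x \<in> R"
  then obtain R' where "R' \<in> join_on S Q" "P \<subseteq> R'"
    using block_subset_join_on[of P Q S] assms by blast
  then show "y \<in> R" using partition_on_same_block[OF join_on_partition assms(1)] P by blast
qed

text \<open>If join blocks \<open>V\<close>, \<open>W\<close> crossed at a < b < c < d, then
  \<open>W \<inter> {a<..<c}\<close> would be saturated, although it contains b and not d. Indeed a
  block leaving this set would have two points outside \<open>V\<close> with exactly one of a, c
  between them, which \<open>gap\<close> excludes.\<close>

lemma join_on_NC: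
  assumes \<pi>: "\<pi> \<in> NC_on S" and \<sigma>: "\<sigma> \<in> NC_on S" and c: "compat \<pi> \<sigma>"
  shows "join_on S (\<pi> \<union> \<sigma>) \<in> NC_on S"
proof -
  let ?Q = "\<pi> \<union> \<sigma>" and ?\<rho> = "join_on S (\<pi> \<union> \<sigma>)"
  have Q: "\<And>P. P \<in> ?Q \<Longrightarrow> P \<subseteq> S" "{} \<notin> ?Q"
    using NC_onD(3)[OF \<pi>] NC_onD(3)[OF \<sigma>] NC_onD(4)[OF \<pi>] NC_onD(4)[OF \<sigma>] by blast+
  note sat = saturated_join_block[OF _ Q]
  \<comment> \<open>The part of \<open>R\<close> between \<open>w\<close> and \<open>w'\<close> is
    saturated, because a block leaving it would cross \<open>W\<close>. As \<open>R\<close> is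
    connected, this part is empty or all of \<open>R\<close>.\<close>
  have gap: "a \<in> {w<..<w'} \<longleftrightarrow> c \<in> {w<..<w'}"
    if R: "R \<in> ?\<rho>" "a \<in> R" "c \<in> R" and W: "W \<in> ?Q" "w \<in> W" "w' \<in> W" "w \<notin> R" "w' \<notin> R" "w < w'"
    for R W w w' a c
  proof -
    have "saturated ?Q (R \<inter> {w<..<w'})"
    proof (rule saturatedI)
      fix P x y assume P: "P \<in> ?Q" "x \<in> P" "y \<in> P" "x \<in> R \<inter> {w<..<w'}"
      have yR: "y \<in> R" using saturatedD[OF sat[OF R(1)] P(1-3)] P(4) by blast
      have ne: "x \<noteq> w" "x \<noteq> w'" "y \<noteq> w" "y \<noteq> w'" using W P(4) yR by auto
      have disj: "P \<noteq> W" using saturatedD[OF sat[OF R(1)] P(1,2)] W P(4) by blast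
      have "w < y \<and> y < w'"
      proof (rule ccontr)
        assume "\<not> (w < y \<and> y < w')"
        then have y: "y < w \<or> w' < y" using ne by linarith
        have nc: False if "noncrossing \<tau>" "P \<in> \<tau>" "W \<in> \<tau>" for \<tau>
        proof (cases "y < w")
          case True
          show ?thesis
            using noncrossingD[OF that True _ _ P(3,2) W(2,3)] W(6) P(4) disj by auto
        next
          case False
          then have "w' < y" using y by blast
          then show ?thesis
            using noncrossingD[OF that(1,3,2) _ _ _ W(2,3) P(2,3)] W(6) P(4) disj by auto
        qed
        \<comment> \<open>Blocks of the same partition do not cross; for blocks of different
          partitions compatibility is applied to the pair of points in the block of
          \<open>\<sigma>\<close>.\<close>
        consider "P \<in> \<pi>" "W \<in> \<pi>" | "P \<in> \<sigma>" "W \<in> \<sigma>" | "P \<in> \<pi>" "W \<in> \<sigma>" | "P \<in> \<sigma>" "W \<in> \<pi>"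
          using P(1) W(1) by blast
        then show False
        proof cases
          case 1
          then show ?thesis using nc NC_onD(2)[OF \<pi>] by blast
        next
          case 2
          then show ?thesis using nc NC_onD(2)[OF \<sigma>] by blast
        next
          case 3
          have "unseparated \<pi> w w'" using c 3 W by (auto simp: compat_def)
          from unseparatedD[OF this 3(1) P(2,3)] show ?thesis using y P(4) ne W(6) by auto
        next
          case 4
          have "unseparated \<pi> x y" using c 4 P by (auto simp: compat_def)
          from unseparatedD[OF this 4(2) W(2,3)] show ?thesis using y P(4) ne W(6) by auto
        qed
      qed
      then show "y \<in> R \<inter> {w<..<w'}" using yR by simp
    qed
    from join_on_same_block[OF R(1-3) this] show ?thesis using R by blast
  qed
  have "noncrossing ?\<rho>"
    unfolding noncrossing_def
  proof clarify
    fix V W a b c d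
    assume *: "V \<in> ?\<rho>" "W \<in> ?\<rho>" "V \<noteq> W" "a < b" "b < c" "c < d" "a \<in> V" "c \<in> V" "b \<in> W" "d \<in> W"
    have disj: "V \<inter> W = {}" using partition_on_same_block[OF join_on_partition *(1,2)] *(3) by blast
    have "saturated ?Q (W \<inter> {a<..<c})"
    proof (rule saturatedI)
      fix P x y assume P: "P \<in> ?Q" "x \<in> P" "y \<in> P" "x \<in> W \<inter> {a<..<c}"
      have yW: "y \<in> W" using saturatedD[OF sat[OF *(2)] P(1-3)] P(4) by blast
      have ne: "x \<notin> V" "y \<notin> V" "y \<noteq> a" "y \<noteq> c" using yW P(4) disj *(7,8) by auto
      show "y \<in> W \<inter> {a<..<c}"
      proof (rule ccontr)
        assume "y \<notin> W \<inter> {a<..<c}"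
        then have "y < a \<or> c < y" using yW ne by auto
        then show False
        proof
          assume "y < a"
          then show False using gap[OF *(1,7,8) P(1,3,2) ne(2,1)] P(4) by auto
        next
          assume "c < y"
          then show False using gap[OF *(1,7,8) P(1,2,3) ne(1,2)] P(4) by auto
        qed
      qed
    qed
    from join_on_same_block[OF *(2,9,10) this] show False using * by auto
  qed
  then show ?thesis using join_on_partition by (simp add: NC_on_def)
qed

text \<open>It suffices to connect neighbours s < s' of \<open>S\<close>. The block \<open>P\<close>
  of \<open>\<pi>\<close> through s' joins s' to its cyclic predecessor p in \<open>P\<close>, and
  the complement joins p to s: any block with an element between them is confined there, since
  otherwise it would cross \<open>P\<close>.\<close>

lemma compl_on_connected:
  assumes S: "finite S" and \<pi>: "\<pi> \<in> NC_on S" and T: "saturated (\<pi> \<union> compl_on S \<pi>) T"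
    and xy: "x \<in> S" "y \<in> S"
  shows "x \<in> T \<longleftrightarrow> y \<in> T"
proof -
  have K: "i \<in> T \<longleftrightarrow> j \<in> T" if "i \<in> S" "j \<in> S" "unseparated \<pi> i j" for i j
  proof -
    have "{j \<in> S. unseparated \<pi> i j} \<in> compl_on S \<pi>" using that by (auto simp: compl_on_def)
    then show ?thesis using saturatedD[OF T, of "{j \<in> S. unseparated \<pi> i j}" i j] that by simp
  qed
  have succ: "s \<in> T \<longleftrightarrow> s' \<in> T" if s: "s \<in> S" "s' \<in> S" "s < s'" "\<And>t. t \<in> S \<Longrightarrow> t \<le> s \<or> s' \<le> t" for s s'
  proof -
    obtain P where P: "P \<in> \<pi>" "s' \<in> P" using NC_onD(1)[OF \<pi>] s(2) by (auto simp: partition_on_def)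
    have PS: "P \<subseteq> S" "finite P" using NC_onD(3)[OF \<pi> P(1)] S finite_subset by blast+
    have sub: "Q \<subseteq> S" if "Q \<in> \<pi>" for Q using NC_onD(3)[OF \<pi> that] .
    have disj: "Q = P" if "Q \<in> \<pi>" "t \<in> Q" "t \<in> P" for Q t
      using partition_on_same_block[OF NC_onD(1)[OF \<pi>] that(1) P(1)] that by blast
    \<comment> \<open>The witness is the cyclic predecessor of \<open>s'\<close> in
      \<open>P\<close>: the last element before \<open>s'\<close>, or \<open>Max P\<close> if
      \<open>s'\<close> is the first element.\<close>
    have "\<exists>p\<in>P. unseparated \<pi> p s"
    proof (cases "\<exists>p\<in>P. p < s'")
      case True
      define p where "p = Max {p \<in> P. p < s'}"
      have p: "p \<in> P" "p < s'" "\<And>q. q \<in> P \<Longrightarrow> q < s' \<Longrightarrow> q \<le> p"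
      proof -
        have "finite {p \<in> P. p < s'}" "{p \<in> P. p < s'} \<noteq> {}" using True PS(2) by auto
        from Max_in[OF this] Max_ge[OF this(1)]
        show "p \<in> P" "p < s'" "\<And>q. q \<in> P \<Longrightarrow> q < s' \<Longrightarrow> q \<le> p" by (auto simp: p_def)
      qed
      have ps: "p \<le> s" using s(4)[of p] p PS by auto
      have X: "b \<le> s \<and> \<not> b \<le> p" if Q: "Q \<in> \<pi>" "a \<in> Q" "b \<in> Q" "a \<le> s" "\<not> a \<le> p" for Q a b
      proof (rule ccontr)
        assume n: "\<not> (b \<le> s \<and> \<not> b \<le> p)"
        have "a \<notin> P" using p(3)[of a] Q s(3) by auto
        then have QP: "Q \<noteq> P" using Q by blast
        then have "b \<noteq> p" "b \<noteq> s'" using disj[OF Q(1,3)] p(1) P(2) by auto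
        moreover have "b \<le> s \<or> s' \<le> b" using s(4) sub Q by blast
        ultimately have "b < p \<or> s' < b" using n by linarith
        then show False
        proof
          assume "b < p"
          then show False
            using noncrossingD[OF NC_onD(2)[OF \<pi>] Q(1) P(1) _ _ _ Q(3,2) p(1) P(2)] Q s(3) QP by auto
        next
          assume "s' < b"
          then show False
            using noncrossingD[OF NC_onD(2)[OF \<pi>] P(1) Q(1) _ _ _ p(1) P(2) Q(2,3)] Q s(3) QP by auto
        qed
      qed
      have "unseparated \<pi> p s"
        unfolding unseparated_def
      proof (intro ballI)
        fix Q a b assume "Q \<in> \<pi>" "a \<in> Q" "b \<in> Q"
        then show "((a \<le> p) = (a \<le> s)) = ((b \<le> p) = (b \<le> s))"
          using X[of Q a b] X[of Q b a] ps by auto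
      qed
      then show ?thesis using p by blast
    next
      case False
      define m where "m = Max P"
      have m: "m \<in> P" "\<And>q. q \<in> P \<Longrightarrow> q \<le> m" using Max_in[OF PS(2)] Max_ge[OF PS(2)] P(2) unfolding m_def by blast+
      have lo: "s' \<le> q" if "q \<in> P" for q using False that by (meson not_le)
      have sm: "s < m" using m(2)[OF P(2)] s(3) by simp
      have X: "b \<le> m \<and> \<not> b \<le> s" if Q: "Q \<in> \<pi>" "a \<in> Q" "b \<in> Q" "a \<le> m" "\<not> a \<le> s" for Q a b
      proof (cases "Q = P")
        case True
        then show ?thesis using m(2) lo Q s(3) by (meson leD le_trans less_le_trans)
      next
        case QP: False
        have ne: "t \<noteq> m" "t \<noteq> s'" if "t \<in> Q" for t using disj[OF Q(1) that] m(1) P(2) QP by auto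
        have a: "s' < a" "a < m" using s(4)[of a] sub[OF Q(1)] Q ne[OF Q(2)] by force+
        show ?thesis
        proof (rule ccontr)
          assume "\<not> (b \<le> m \<and> \<not> b \<le> s)"
          then have "m < b \<or> b < s'" using s(3) by linarith
          then show False
          proof
            assume "b < s'"
            then show False
              using noncrossingD[OF NC_onD(2)[OF \<pi>] Q(1) P(1) _ _ _ Q(3,2) P(2) m(1)] a QP by auto
          next
            assume "m < b"
            then show False
              using noncrossingD[OF NC_onD(2)[OF \<pi>] P(1) Q(1) _ _ _ P(2) m(1) Q(2,3)] a QP by auto
          qed
        qed
      qed
      have "unseparated \<pi> m s"
        unfolding unseparated_def
      proof (intro ballI)
        fix Q a b assume "Q \<in> \<pi>" "a \<in> Q" "b \<in> Q"
        then show "((a \<le> m) = (a \<le> s)) = ((b \<le> m) = (b \<le> s))"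
          using X[of Q a b] X[of Q b a] sm by auto
      qed
      then show ?thesis using m by blast
    qed
    then obtain p where p: "p \<in> P" "unseparated \<pi> p s" by blast
    have "s' \<in> T \<longleftrightarrow> p \<in> T" using saturatedD[OF T, of P s' p] P p by blast
    then show ?thesis using K[OF _ s(1) p(2)] p PS by blast
  qed
  have "z \<in> T \<longleftrightarrow> Min S \<in> T" if "z \<in> S" for z
    using that
  proof (induction z rule: less_induct)
    case (less z)
    show ?case
    proof (cases "z = Min S")
      case False
      let ?L = "{t \<in> S. t < z}"
      have L: "finite ?L" "?L \<noteq> {}"
      proof -
        have "Min S \<in> S" using Min_in[OF S] less.prems by blast
        then have "Min S \<in> ?L" using False Min_le[OF S less.prems] by simp
        then show "?L \<noteq> {}" by blast
      qed (use S in simp)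
      define t where "t = Max ?L"
      have t: "t \<in> S" "t < z" "\<And>u. u \<in> S \<Longrightarrow> u < z \<Longrightarrow> u \<le> t"
        using Max_in[OF L] L by (auto simp: t_def)
      have "t \<in> T \<longleftrightarrow> z \<in> T"
        using t less.prems by (intro succ) (auto simp: not_le)
      then show ?thesis using less.IH[OF t(2,1)] by blast
    qed simp
  qed
  then show ?thesis using xy by blast
qed

lemma noncrossing_between:
  assumes "noncrossing \<rho>" "partition_on S \<rho>" and VW: "V \<in> \<rho>" "W \<in> \<rho>" "V \<noteq> W"
    and ab: "a \<in> V" "b \<in> V" and ij: "i \<in> W" "j \<in> W" and "i < a" "a < j"
  shows "i < b \<and> b < j"
proof (rule ccontr)
  assume n: "\<not> (i < b \<and> b < j)"
  have "b \<noteq> i" "b \<noteq> j" using partition_on_same_block[OF assms(2) VW(1,2)] ab ij VW(3) by blast+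
  then consider "b < i" | "j < b" using n by linarith
  then show False
  proof cases
    case 1
    then show ?thesis
      using noncrossingD[OF assms(1) VW(1,2) 1 assms(10,11) ab(2,1) ij] VW(3) by simp
  next
    case 2
    then show ?thesis
      using noncrossingD[OF assms(1) VW(2,1) assms(10,11) 2 ij ab] VW(3) by simp
  qed
qed

text \<open>If a block \<open>B\<close> of the complement contained several blocks of \<open>\<sigma>\<close>, let \<open>U\<close> be one of them of
  least spread, so that \<open>B\<close> has no other points between the ends of \<open>U\<close>. Cutting \<open>B\<close> at an end of
  \<open>U\<close> and at a point of \<open>B\<close> next to \<open>U\<close> gives an interval that is saturated for both \<open>\<pi>\<close> and \<open>\<sigma>\<close>.\<close>

lemma compl_on_unique:
  assumes S: "finite S" and \<pi>: "\<pi> \<in> NC_on S" and \<sigma>: "\<sigma> \<in> NC_on S" and c: "compat \<pi> \<sigma>"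
    and conn: "\<And>T x y. saturated (\<pi> \<union> \<sigma>) T \<Longrightarrow> x \<in> S \<Longrightarrow> y \<in> S \<Longrightarrow> x \<in> T \<longleftrightarrow> y \<in> T"
  shows "compl_on S \<pi> = \<sigma>"
proof -
  let ?K = "compl_on S \<pi>"
  have P: "partition_on S \<sigma>" and ncK: "noncrossing ?K" and PK: "partition_on S ?K"
    using NC_onD[OF \<sigma>] NC_onD[OF compl_on_NC] by blast+
  have ref: "refines S \<sigma> ?K" by (rule refines_compl_on[OF P c])
  have "\<exists>U\<in>\<sigma>. B \<subseteq> U" if B: "B \<in> ?K" for B
  proof (rule ccontr)
    assume neg: "\<not> (\<exists>U\<in>\<sigma>. B \<subseteq> U)"
    have BS: "B \<subseteq> S" "finite B" "B \<noteq> {}"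
      using NC_onD(3,4)[OF compl_on_NC B] finite_subset[OF _ S] by blast+
    have in_B: "W \<subseteq> B" if W: "W \<in> \<sigma>" "b \<in> W" "b \<in> B" for W b
    proof -
      obtain B' where B': "B' \<in> ?K" "W \<subseteq> B'" using ref W(1) by (auto simp: refines_def)
      then show ?thesis using partition_on_same_block[OF PK B B'(1)] W by blast
    qed
    have block: "\<exists>W\<in>\<sigma>. b \<in> W" if "b \<in> B" for b
      using P that BS by (auto simp: partition_on_def)
    \<comment> \<open>For \<open>u < v\<close> in \<open>B\<close>, the set \<open>{u<..v}\<close>
      is saturated for \<open>\<pi>\<close>, as \<open>u\<close> and \<open>v\<close> are
      unseparated, and for the blocks of \<open>\<sigma>\<close> outside \<open>B\<close>, as the
      complement is noncrossing. It contains \<open>v\<close> and not \<open>u\<close>, so by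
      connectedness some block of \<open>\<sigma>\<close> inside \<open>B\<close> must be
      cut.\<close>
    have no_cut: False
      if uv: "u \<in> B" "v \<in> B" "u < v"
        and W: "\<And>W x y. W \<in> \<sigma> \<Longrightarrow> W \<subseteq> B \<Longrightarrow> x \<in> W \<Longrightarrow> y \<in> W \<Longrightarrow> x \<in> {u<..v} \<Longrightarrow> y \<in> {u<..v}"
      for u v
    proof -
      have un: "unseparated \<pi> u v" using compl_on_same_block[OF B uv(1)] uv BS by blast
      have "saturated (\<pi> \<union> \<sigma>) {u<..v}"
      proof (rule saturatedI)
        fix Q x y assume Q: "Q \<in> \<pi> \<union> \<sigma>" "x \<in> Q" "y \<in> Q" "x \<in> {u<..v}"
        show "y \<in> {u<..v}"
        proof (cases "Q \<in> \<pi>")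
          case True
          then show ?thesis using unseparatedD[OF un True Q(2,3)] Q(4) uv(3) by auto
        next
          case False
          then have Q\<sigma>: "Q \<in> \<sigma>" using Q by blast
          show ?thesis
          proof (cases "Q \<subseteq> B")
            case True
            then show ?thesis using W[OF Q\<sigma> True Q(2-4)] by blast
          next
            case nB: False
            obtain B' where B': "B' \<in> ?K" "Q \<subseteq> B'" using ref Q\<sigma> by (auto simp: refines_def)
            have "B' \<noteq> B" using nB B' by blast
            moreover have "x \<noteq> v" using in_B[OF Q\<sigma> Q(2)] nB uv by blast
            moreover have "x \<in> B'" "y \<in> B'" using Q B' by blast+
            ultimately show ?thesis
              using noncrossing_between[OF ncK PK B'(1) B, of x y u v] Q(4) uv by simp
          qed
        qed
      qed
      then show False using conn[of "{u<..v}" u v] uv BS by auto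
    qed
    define spread where "spread U = Max U - Min U" for U :: "nat set"
    obtain b where "b \<in> B" using BS by blast
    moreover obtain U0 where "U0 \<in> \<sigma>" "b \<in> U0" using block[OF \<open>b \<in> B\<close>] by blast
    ultimately have U0: "U0 \<in> \<sigma> \<and> U0 \<subseteq> B" using in_B by blast
    then obtain U where U: "U \<in> \<sigma>" "U \<subseteq> B"
      and least: "\<And>W. W \<in> \<sigma> \<Longrightarrow> W \<subseteq> B \<Longrightarrow> spread U \<le> spread W"
      using ex_has_least_nat[of "\<lambda>U. U \<in> \<sigma> \<and> U \<subseteq> B", OF U0, of spread] by blast
    have fin: "finite W" "W \<noteq> {}" if "W \<in> \<sigma>" for W
      using NC_onD(3,4)[OF \<sigma> that] S finite_subset by blast+
    define lo hi where "lo = Min U" and "hi = Max U"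
    have lohi: "lo \<in> U" "hi \<in> U" "\<And>x. x \<in> U \<Longrightarrow> lo \<le> x \<and> x \<le> hi"
      using fin[OF U(1)] by (auto simp: lo_def hi_def)
    \<comment> \<open>A point of \<open>B\<close> between the ends of \<open>U\<close> but outside
      \<open>U\<close> would lie in a block of \<open>\<sigma>\<close> nested strictly inside
      \<open>U\<close>, contradicting the least spread.\<close>
    have interval: "b \<in> U" if b: "b \<in> B" "lo \<le> b" "b \<le> hi" for b
    proof (rule ccontr)
      assume bU: "b \<notin> U"
      then have bb: "lo < b" "b < hi" using b lohi by (auto simp: le_less)
      obtain W where W: "W \<in> \<sigma>" "b \<in> W" using block b by blast
      have "W \<noteq> U" using bU W by blast
      then have "lo < x \<and> x < hi" if "x \<in> W" for x
        using noncrossing_between[OF NC_onD(2)[OF \<sigma>] P W(1) U(1) _ W(2) that lohi(1,2)] bb by blast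
      then have "lo < Min W" "Max W < hi" using fin[OF W(1)] by auto
      moreover have "Min W \<le> Max W" using fin[OF W(1)] by (metis Max_ge Min_in)
      ultimately have "spread W < spread U" unfolding spread_def lo_def hi_def by linarith
      then show False using least[OF W(1) in_B[OF W b(1)]] by simp
    qed
    show False
    proof (cases "\<exists>p\<in>B. p < lo")
      case True
      \<comment> \<open>With this \<open>p\<close>, the points of \<open>B\<close> in
        \<open>{p<..hi}\<close> are exactly those of \<open>U\<close>.\<close>
      define p where "p = Max {p \<in> B. p < lo}"
      have L: "finite {p \<in> B. p < lo}" "{p \<in> B. p < lo} \<noteq> {}" using True BS by auto
      have p: "p \<in> B" "p < lo" "\<And>q. q \<in> B \<Longrightarrow> q < lo \<Longrightarrow> q \<le> p"
        using Max_in[OF L] Max_ge[OF L(1)] by (auto simp: p_def)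
      show False
      proof (rule no_cut[of p hi])
        show "p \<in> B" "hi \<in> B" "p < hi" using p lohi U by (auto dest: le_less_trans less_le_trans)
        fix W x y assume W: "W \<in> \<sigma>" "W \<subseteq> B" "x \<in> W" "y \<in> W" "x \<in> {p<..hi}"
        have "lo \<le> x" using p(3)[of x] W by (meson greaterThanAtMost_iff leD not_le subsetD)
        then have "x \<in> U" using interval W by auto
        then have "W = U" using partition_on_same_block[OF P W(1) U(1)] W by blast
        then show "y \<in> {p<..hi}" using W lohi(3)[of y] p by auto
      qed
    next
      case False
      \<comment> \<open>Now \<open>U\<close> is an initial segment of \<open>B\<close>, and the cut
        is made on its other side: the points of \<open>B\<close> in \<open>{hi<..Max B}\<close> are
        exactly those outside \<open>U\<close>.\<close>
      then have lo: "lo \<le> b" if "b \<in> B" for b using that by (meson not_le)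
      obtain b where b: "b \<in> B" "b \<notin> U" using neg U by blast
      have "hi < b" using interval[OF b(1) lo] b by (meson not_le)
      have q: "Max B \<in> B" "\<And>b. b \<in> B \<Longrightarrow> b \<le> Max B" using BS by auto
      show False
      proof (rule no_cut[of hi "Max B"])
        show "hi \<in> B" "Max B \<in> B" "hi < Max B" using lohi U q b \<open>hi < b\<close> by (auto dest: less_le_trans)
        fix W x y assume W: "W \<in> \<sigma>" "W \<subseteq> B" "x \<in> W" "y \<in> W" "x \<in> {hi<..Max B}"
        have "W \<noteq> U" using W lohi(3)[of x] by auto
        then have "y \<notin> U" using partition_on_same_block[OF P W(1) U(1) W(4)] by blast
        then have "hi < y" using interval[of y] lo[of y] W by (meson not_le subsetD)
        then show "y \<in> {hi<..Max B}" using q W by auto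
      qed
    qed
  qed
  then have "refines S ?K \<sigma>" unfolding refines_def using P PK by blast
  then show ?thesis using ref by (rule refines_asym)
qed

section \<open>The relative Kreweras complement of \<open>\<pi>\<close> in \<open>\<rho>\<close>,
  and the bijection it gives\<close>

definition glued_compl :: "nat set set \<Rightarrow> nat set set \<Rightarrow> nat set set"
  where "glued_compl \<pi> \<rho> = (\<Union>V\<in>\<rho>. compl_on V (blocks_in \<pi> V))"

lemma glued_compl_NC: "\<rho> \<in> NC_on S \<Longrightarrow> glued_compl \<pi> \<rho> \<in> NC_on S"
  unfolding glued_compl_def by (rule glue_NC_on) (auto intro: compl_on_NC)

lemma blocks_in_cases:
  assumes "refines S \<pi> \<rho>" "P \<in> \<pi>"
  obtains V where "V \<in> \<rho>" "P \<in> blocks_in \<pi> V" "P \<subseteq> V"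
  using assms by (auto simp: refines_def blocks_in_def)

text \<open>Compare a block of \<open>\<pi>\<close> inside \<open>V'\<close> with a block of the
  complement inside \<open>V\<close>. For \<open>V' = V\<close> they are compatible by the
  construction in \<open>V\<close>. Otherwise they cannot alternate, because \<open>V'\<close> and
  \<open>V\<close> are disjoint and do not cross; disjointness also removes the difference between
  \<le> and <.\<close>

lemma compat_glued_compl:
  assumes \<rho>: "\<rho> \<in> NC_on S" and r: "refines S \<pi> \<rho>"
  shows "compat \<pi> (glued_compl \<pi> \<rho>)"
  unfolding compat_def unseparated_def
proof (intro ballI)
  fix W i j P a b
  assume *: "W \<in> glued_compl \<pi> \<rho>" "i \<in> W" "j \<in> W" "P \<in> \<pi>" "a \<in> P" "b \<in> P"
  obtain V where V: "V \<in> \<rho>" "W \<in> compl_on V (blocks_in \<pi> V)" using * by (auto simp: glued_compl_def)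
  have WV: "W \<subseteq> V" using NC_onD(3)[OF compl_on_NC V(2)] .
  obtain V' where V': "V' \<in> \<rho>" "P \<in> blocks_in \<pi> V'" "P \<subseteq> V'" by (rule blocks_in_cases[OF r *(4)])
  show "((a \<le> i) = (a \<le> j)) = ((b \<le> i) = (b \<le> j))"
  proof (cases "V' = V")
    case True
    have "unseparated (blocks_in \<pi> V) i j"
      using compl_on_same_block[OF V(2) *(2)] * WV by blast
    then show ?thesis using unseparatedD True V' * by blast
  next
    case False
    have bt: "k < d \<and> d < l" if "k < c" "c < l" "c \<in> P" "d \<in> P" "k \<in> W" "l \<in> W" for c d k l
      using noncrossing_between[OF NC_onD(2,1)[OF \<rho>] V'(1) V(1) False, of c d k l] that WV V' by blast
    have ne: "c \<noteq> k" if "c \<in> P" "k \<in> W" for c k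
      using partition_on_same_block[OF NC_onD(1)[OF \<rho>] V'(1) V(1)] False that WV V' by blast
    have X: "\<not> (c \<le> k \<and> \<not> d \<le> k \<and> d \<le> l) \<and> \<not> (\<not> c \<le> k \<and> c \<le> l \<and> \<not> d \<le> l)"
      if "c \<in> P" "d \<in> P" "k \<in> W" "l \<in> W" for c d k l
      using bt[of k d l c] bt[of k c l d] ne that by (metis leD le_less not_le)
    show ?thesis
      using X[OF *(5,6,2,3)] X[OF *(6,5,2,3)] X[OF *(5,6,3,2)] X[OF *(6,5,3,2)] by argo
  qed
qed

text \<open>Every block of \<open>\<rho>\<close> is saturated, so the join refines
  \<open>\<rho>\<close>. Conversely, inside a block of \<open>\<rho>\<close> the restriction of
  \<open>\<pi>\<close> and its complement connect all points.\<close>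

lemma join_glued_compl:
  assumes S: "finite S" and \<pi>: "\<pi> \<in> NC_on S" and \<rho>: "\<rho> \<in> NC_on S" and r: "refines S \<pi> \<rho>"
  shows "join_on S (\<pi> \<union> glued_compl \<pi> \<rho>) = \<rho>"
proof (rule refines_asym)
  let ?Q = "\<pi> \<union> glued_compl \<pi> \<rho>"
  have P: "partition_on S \<rho>" by (rule NC_onD(1)[OF \<rho>])
  have "\<exists>V\<in>\<rho>. B \<subseteq> V" if "B \<in> ?Q" for B
    using that r NC_onD(3)[OF compl_on_NC] by (auto simp: glued_compl_def refines_def) blast
  then have sat: "saturated ?Q V" if "V \<in> \<rho>" for V
    using partition_on_same_block[OF P that] by (intro saturatedI) blast
  have VS: "V \<subseteq> S" if "V \<in> \<rho>" for V using NC_onD(3)[OF \<rho> that] .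
  show "refines S (join_on S ?Q) \<rho>"
    unfolding refines_def
  proof (intro conjI ballI P join_on_partition)
    fix R assume R: "R \<in> join_on S ?Q"
    then have RS: "R \<subseteq> S" "R \<noteq> {}" using join_on_partition[of S ?Q] by (auto simp: partition_on_def)
    then obtain x V where x: "x \<in> R" "x \<in> V" "V \<in> \<rho>" using partition_onD1[OF P] by blast
    then show "\<exists>V\<in>\<rho>. R \<subseteq> V" using join_on_same_block[OF R x(1) _ sat[OF x(3)]] by blast
  qed
  show "refines S \<rho> (join_on S ?Q)"
    unfolding refines_def
  proof (intro conjI ballI P join_on_partition)
    fix V assume V: "V \<in> \<rho>"
    then obtain x where x: "x \<in> V" using NC_onD(4)[OF \<rho>] by blast
    have "x \<in> T \<longleftrightarrow> y \<in> T" if "saturated ?Q T" "y \<in> V" for y T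
    proof (rule compl_on_connected[OF _ blocks_in_NC_on[OF \<pi> r V] _ x that(2)])
      show "finite V" using VS[OF V] S finite_subset by blast
      show "saturated (blocks_in \<pi> V \<union> compl_on V (blocks_in \<pi> V)) T"
        using that(1) V unfolding saturated_def glued_compl_def blocks_in_def by blast
    qed
    then have "V \<subseteq> {y \<in> S. \<forall>T. saturated ?Q T \<longrightarrow> (x \<in> T \<longleftrightarrow> y \<in> T)}" using VS[OF V] by blast
    then show "\<exists>R\<in>join_on S ?Q. V \<subseteq> R" using x VS[OF V] unfolding join_on_def by blast
  qed
qed

text \<open>Inside a block \<open>V\<close> of the join, the restrictions of \<open>\<pi>\<close>
  and \<open>\<sigma>\<close> are compatible and connect \<open>V\<close>: a set saturated for them
  becomes, once cut down to \<open>V\<close>, saturated for all of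
  \<open>\<pi> \<union> \<sigma>\<close>. Uniqueness of the complement then applies in each
  \<open>V\<close>.\<close>

lemma glued_compl_join:
  assumes S: "finite S" and \<pi>: "\<pi> \<in> NC_on S" and \<sigma>: "\<sigma> \<in> NC_on S" and c: "compat \<pi> \<sigma>"
  shows "glued_compl \<pi> (join_on S (\<pi> \<union> \<sigma>)) = \<sigma>"
    and "refines S \<pi> (join_on S (\<pi> \<union> \<sigma>))"
proof -
  let ?Q = "\<pi> \<union> \<sigma>" and ?\<rho> = "join_on S (\<pi> \<union> \<sigma>)"
  have Q: "P \<subseteq> S" "P \<noteq> {}" if "P \<in> ?Q" for P
    using that NC_onD(3,4)[OF \<pi>] NC_onD(3,4)[OF \<sigma>] by blast+
  have sub: "\<exists>R\<in>?\<rho>. P \<subseteq> R" if "P \<in> ?Q" for P using block_subset_join_on[OF that Q[OF that]] .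
  show r\<pi>: "refines S \<pi> ?\<rho>"
    unfolding refines_def using sub join_on_partition NC_onD(1)[OF \<pi>] by blast
  have r\<sigma>: "refines S \<sigma> ?\<rho>"
    unfolding refines_def using sub join_on_partition NC_onD(1)[OF \<sigma>] by blast
  have "compl_on V (blocks_in \<pi> V) = blocks_in \<sigma> V" if V: "V \<in> ?\<rho>" for V
  proof (rule compl_on_unique[OF _ blocks_in_NC_on[OF \<pi> r\<pi> V] blocks_in_NC_on[OF \<sigma> r\<sigma> V]])
    have VS: "V \<subseteq> S" using join_on_partition[of S ?Q] V by (auto simp: partition_on_def)
    then show "finite V" using S finite_subset by blast
    have "unseparated (blocks_in \<pi> V) i j" if "unseparated \<pi> i j" for i j
      using that by (rule unseparated_mono[rotated]) (auto simp: blocks_in_def)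
    then show "compat (blocks_in \<pi> V) (blocks_in \<sigma> V)"
      using c unfolding compat_def by (auto simp: blocks_in_def)
    fix T x y
    assume T: "saturated (blocks_in \<pi> V \<union> blocks_in \<sigma> V) T" and xy: "x \<in> V" "y \<in> V"
    have "saturated ?Q (T \<inter> V)"
    proof (rule saturatedI)
      fix P a b assume P: "P \<in> ?Q" "a \<in> P" "b \<in> P" "a \<in> T \<inter> V"
      obtain R where R: "R \<in> ?\<rho>" "P \<subseteq> R" using sub P by blast
      then have "R = V" using partition_on_same_block[OF join_on_partition R(1) V] P by blast
      then have "P \<in> blocks_in \<pi> V \<union> blocks_in \<sigma> V" using P R by (auto simp: blocks_in_def)
      then show "b \<in> T \<inter> V" using saturatedD[OF T _ P(2,3)] P(3,4) R \<open>R = V\<close> by blast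
    qed
    from join_on_same_block[OF V xy this] show "x \<in> T \<longleftrightarrow> y \<in> T" using xy by blast
  qed
  then show "glued_compl \<pi> ?\<rho> = \<sigma>"
    unfolding glued_compl_def using Union_blocks_in[OF r\<sigma>] by simp
qed

lemma sum_glued_compl:
  assumes S: "finite S" and \<pi>: "\<pi> \<in> NC_on S"
  shows "(\<Sum>\<rho> | \<rho> \<in> NC_on S \<and> refines S \<pi> \<rho>. h (glued_compl \<pi> \<rho>))
       = (\<Sum>\<sigma> | \<sigma> \<in> NC_on S \<and> compat \<pi> \<sigma>. h \<sigma>)"
  by (rule sum.reindex_bij_witness[where i = "\<lambda>\<sigma>. join_on S (\<pi> \<union> \<sigma>)" and j = "glued_compl \<pi>"])
    (use assms in \<open>auto simp: join_glued_compl glued_compl_join glued_compl_NC compat_glued_compl join_on_NC\<close>)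

subsection \<open>Boxed convolution and products\<close>

text \<open>\<open>Kr\<close> renumbers the positions of the subword from \<open>1\<close>.
  Relabelling by \<open>enum V\<close> turns it into a complement on \<open>V\<close>, since the
  complement depends only on the order.\<close>

lemma boxed_convolution_subword:
  assumes V: "V \<subseteq> {1..length w}" "V \<noteq> {}"
  shows "boxed_convolution f g (subword w V) =
    (\<Sum>\<pi>\<in>NC_on V. (\<Prod>P\<in>\<pi>. f (subword w P)) * (\<Prod>W\<in>compl_on V \<pi>. g (subword w W)))"
proof -
  have fin: "finite V" using V finite_subset by blast
  let ?h = "\<lambda>\<pi>. (\<Prod>P\<in>\<pi>. f (subword w P)) * (\<Prod>W\<in>compl_on V \<pi>. g (subword w W))"
  have "boxed_convolution f g (subword w V) = (\<Sum>\<pi>\<in>NC (card V).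
      (\<Prod>P\<in>\<pi>. f (subword (subword w V) P)) * (\<Prod>W\<in>Kr (card V) \<pi>. g (subword (subword w V) W)))"
    using subword_Nil_iff[OF V(1)] V(2) length_subword[OF V(1)] by (simp add: boxed_convolution_def)
  also have "\<dots> = (\<Sum>\<pi>\<in>NC (card V). ?h ((`) (enum V) ` \<pi>))"
  proof (rule sum.cong[OF refl])
    fix \<pi> assume \<pi>: "\<pi> \<in> NC (card V)"
    have sub: "\<Union>\<pi> \<subseteq> {1..card V}" using \<pi> by (auto simp: NC_def partition_on_def)
    have K: "(`) (enum V) ` compl_on {1..card V} \<pi> = compl_on V ((`) (enum V) ` \<pi>)"
      using compl_on_image[OF strict_mono_on_enum sub] enum_image[OF fin] by simp
    have "\<Union>(compl_on {1..card V} \<pi>) \<subseteq> {1..card V}"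
      using compl_on_partition[of "{1..card V}" \<pi>] by (auto simp: partition_on_def)
    from prod_image_subword[OF V(1) this, of g] prod_image_subword[OF V(1) sub, of f]
    show "(\<Prod>P\<in>\<pi>. f (subword (subword w V) P)) * (\<Prod>W\<in>Kr (card V) \<pi>. g (subword (subword w V) W))
        = ?h ((`) (enum V) ` \<pi>)"
      unfolding Kr_eq_compl_on[OF \<pi>] K by simp
  qed
  also have "\<dots> = (\<Sum>\<pi>\<in>NC_on V. ?h \<pi>)" by (rule sum_NC_subword[OF V(1)])
  finally show ?thesis .
qed

text \<open>Expanding the product over the blocks of \<open>\<rho>\<close> pairs each
  \<open>\<pi>\<close> below \<open>\<rho>\<close> with its relative complement. Exchanging the sums
  fixes \<open>\<pi>\<close> and lets \<open>\<rho>\<close> run above it, so that the bijection can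
  replace \<open>\<rho>\<close> by \<open>\<sigma>\<close>.\<close>

lemma sum_NC_boxed_convolution:
  "(\<Sum>\<rho>\<in>NC (length w). \<Prod>V\<in>\<rho>. boxed_convolution f g (subword w V)) =
   (\<Sum>\<pi>\<in>NC (length w). \<Sum>\<sigma> | \<sigma> \<in> NC (length w) \<and> compat \<pi> \<sigma>.
      (\<Prod>P\<in>\<pi>. f (subword w P)) * (\<Prod>W\<in>\<sigma>. g (subword w W)))"
proof -
  let ?S = "{1..length w}" and ?N = "NC_on {1..length w}"
  let ?F = "\<lambda>\<pi>. \<Prod>P\<in>\<pi>. f (subword w P)" and ?G = "\<lambda>\<sigma>. \<Prod>W\<in>\<sigma>. g (subword w W)"
  have "(\<Prod>V\<in>\<rho>. boxed_convolution f g (subword w V)) =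
      (\<Sum>\<pi> | \<pi> \<in> ?N \<and> refines ?S \<pi> \<rho>. ?F \<pi> * ?G (glued_compl \<pi> \<rho>))" if \<rho>: "\<rho> \<in> ?N" for \<rho>
  proof -
    have "(\<Prod>V\<in>\<rho>. boxed_convolution f g (subword w V)) =
        (\<Prod>V\<in>\<rho>. \<Sum>\<pi>\<in>NC_on V. ?F \<pi> * ?G (compl_on V \<pi>))"
      using NC_onD(3,4)[OF \<rho>] by (intro prod.cong refl boxed_convolution_subword) auto
    also have "\<dots> = (\<Sum>\<pi> | \<pi> \<in> ?N \<and> refines ?S \<pi> \<rho>.
        \<Prod>V\<in>\<rho>. ?F (blocks_in \<pi> V) * ?G (compl_on V (blocks_in \<pi> V)))"
      by (rule prod_sum_NC_on[OF _ \<rho>]) simp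
    also have "\<dots> = (\<Sum>\<pi> | \<pi> \<in> ?N \<and> refines ?S \<pi> \<rho>. ?F \<pi> * ?G (glued_compl \<pi> \<rho>))"
    proof (rule sum.cong[OF refl])
      fix \<pi> assume "\<pi> \<in> {\<pi> \<in> ?N. refines ?S \<pi> \<rho>}"
      then have r: "refines ?S \<pi> \<rho>" by blast
      have "(\<Prod>V\<in>\<rho>. ?F (blocks_in \<pi> V)) = ?F \<pi>" by (rule prod_blocks_in[OF _ r]) simp
      moreover have "(\<Prod>V\<in>\<rho>. ?G (compl_on V (blocks_in \<pi> V))) = ?G (glued_compl \<pi> \<rho>)"
        unfolding glued_compl_def
        by (rule prod_Union_blocks[OF _ NC_onD(1)[OF \<rho>]]) (auto intro: compl_on_partition)
      ultimately show "(\<Prod>V\<in>\<rho>. ?F (blocks_in \<pi> V) * ?G (compl_on V (blocks_in \<pi> V)))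
          = ?F \<pi> * ?G (glued_compl \<pi> \<rho>)"
        by (simp add: prod.distrib)
    qed
    finally show ?thesis .
  qed
  then have "(\<Sum>\<rho>\<in>?N. \<Prod>V\<in>\<rho>. boxed_convolution f g (subword w V)) =
      (\<Sum>\<rho>\<in>?N. \<Sum>\<pi> | \<pi> \<in> ?N \<and> refines ?S \<pi> \<rho>. ?F \<pi> * ?G (glued_compl \<pi> \<rho>))"
    by (rule sum.cong[OF refl])
  also have "\<dots> = (\<Sum>\<pi>\<in>?N. \<Sum>\<rho> | \<rho> \<in> ?N \<and> refines ?S \<pi> \<rho>. ?F \<pi> * ?G (glued_compl \<pi> \<rho>))"
    by (rule sum.swap_restrict) (simp_all add: finite_NC_on)
  also have "\<dots> = (\<Sum>\<pi>\<in>?N. \<Sum>\<sigma> | \<sigma> \<in> ?N \<and> compat \<pi> \<sigma>. ?F \<pi> * ?G \<sigma>)"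
    by (intro sum.cong refl sum_glued_compl[where h = "\<lambda>\<sigma>. ?F _ * ?G \<sigma>"]) auto
  finally show ?thesis by (simp_all add: NC_eq_NC_on)
qed

section \<open>Partitions of \<open>2 * n\<close> points whose blocks have one parity\<close>

lemma NC_interlace:
  assumes \<pi>: "\<pi> \<in> NC n" and \<sigma>: "\<sigma> \<in> NC n" and c: "compat \<pi> \<sigma>"
  shows "interlace \<pi> \<sigma> \<in> NC (2 * n)"
proof -
  let ?o = "\<lambda>i::nat. 2 * i - 1" and ?e = "\<lambda>i::nat. 2 * i"
  have o: "partition_on (?o ` {1..n}) ((`) ?o ` \<pi>)"
    using \<pi> by (intro partition_on_image) (auto simp: NC_def inj_on_def)
  have e: "partition_on (?e ` {1..n}) ((`) ?e ` \<sigma>)"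
    using \<sigma> by (intro partition_on_image) (auto simp: NC_def inj_on_def)
  have disj: "?o ` {1..n} \<inter> ?e ` {1..n} = {}" by (auto, presburger)
  have un: "?o ` {1..n} \<union> ?e ` {1..n} = {1..2 * n}"
  proof (intro equalityI subsetI)
    fix u assume "u \<in> {1..2 * n}"
    then show "u \<in> ?o ` {1..n} \<union> ?e ` {1..n}"
      by (cases "even u") (auto elim!: evenE oddE intro: image_eqI[of _ _ "Suc _"])
  qed auto
  have "partition_on {1..2 * n} (interlace \<pi> \<sigma>)"
  proof (rule partition_onI)
    show "\<Union>(interlace \<pi> \<sigma>) = {1..2 * n}"
      using partition_onD1[OF o] partition_onD1[OF e] un by (auto simp: interlace_def)
    show "{} \<notin> interlace \<pi> \<sigma>"
      using partition_onD3[OF o] partition_onD3[OF e] by (auto simp: interlace_def)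
    fix p q assume pq: "p \<in> interlace \<pi> \<sigma>" "q \<in> interlace \<pi> \<sigma>" "p \<noteq> q"
    have sub: "P \<subseteq> ?o ` {1..n}" if "P \<in> (`) ?o ` \<pi>" for P using partition_onD1[OF o] that by blast
    have sub': "P \<subseteq> ?e ` {1..n}" if "P \<in> (`) ?e ` \<sigma>" for P using partition_onD1[OF e] that by blast
    consider "p \<in> (`) ?o ` \<pi>" "q \<in> (`) ?o ` \<pi>" | "p \<in> (`) ?e ` \<sigma>" "q \<in> (`) ?e ` \<sigma>"
      | "p \<in> (`) ?o ` \<pi>" "q \<in> (`) ?e ` \<sigma>" | "p \<in> (`) ?e ` \<sigma>" "q \<in> (`) ?o ` \<pi>"
      using pq(1,2) unfolding interlace_def by blast
    then show "disjnt p q"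
    proof cases
      case 1
      then show ?thesis using partition_on_same_block[OF o 1] pq(3) unfolding disjnt_def by blast
    next
      case 2
      then show ?thesis using partition_on_same_block[OF e 2] pq(3) unfolding disjnt_def by blast
    next
      case 3
      then show ?thesis using sub[OF 3(1)] sub'[OF 3(2)] disj unfolding disjnt_def by blast
    next
      case 4
      then show ?thesis using sub'[OF 4(1)] sub[OF 4(2)] disj unfolding disjnt_def by blast
    qed
  qed
  then show ?thesis using compat_iff_noncrossing_interlace[OF \<pi> \<sigma>] c by (simp add: NC_def)
qed

lemma noncrossing_subset:
  assumes "noncrossing \<pi>" "\<sigma> \<subseteq> \<pi>"
  shows "noncrossing \<sigma>"
  unfolding noncrossing_def
proof clarify
  fix V W a b c d
  assume *: "V \<in> \<sigma>" "W \<in> \<sigma>" "V \<noteq> W" "a < b" "b < c" "c < d" "a \<in> V" "c \<in> V" "b \<in> W" "d \<in> W"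
  then show False
    using noncrossingD[OF assms(1) subsetD[OF assms(2)] subsetD[OF assms(2)] *(4-10)] by simp
qed

text \<open>By \<open>hom\<close>, a block satisfies \<open>Q\<close> everywhere or nowhere, so the
  selected blocks cover exactly the points with \<open>Q\<close>. Applied once to each parity, with
  \<open>r\<close> as the renumbering.\<close>

lemma blocks_of_parity:
  fixes Q :: "nat \<Rightarrow> bool" and r :: "nat \<Rightarrow> nat"
  assumes \<tau>: "\<tau> \<in> NC_on T" and hom: "\<And>U u v. U \<in> \<tau> \<Longrightarrow> u \<in> U \<Longrightarrow> v \<in> U \<Longrightarrow> Q u \<Longrightarrow> Q v"
    and r: "strict_mono_on {u \<in> T. Q u} r"
  shows "(`) r ` {U \<in> \<tau>. \<forall>u\<in>U. Q u} \<in> NC_on (r ` {u \<in> T. Q u})"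
proof (rule image_NC_on[OF r])
  let ?\<tau> = "{U \<in> \<tau>. \<forall>u\<in>U. Q u}"
  have "partition_on {u \<in> T. Q u} ?\<tau>"
  proof (rule partition_onI)
    show "\<Union>?\<tau> = {u \<in> T. Q u}"
      using partition_onD1[OF NC_onD(1)[OF \<tau>]] hom by blast
    show "{} \<notin> ?\<tau>" using NC_onD(4)[OF \<tau>] by blast
    fix p q assume pq: "p \<in> ?\<tau>" "q \<in> ?\<tau>" "p \<noteq> q"
    then have "p \<in> \<tau>" "q \<in> \<tau>" by blast+
    from partition_on_same_block[OF NC_onD(1)[OF \<tau>] this] show "disjnt p q"
      using pq(3) unfolding disjnt_def by blast
  qed
  moreover have "noncrossing ?\<tau>" by (rule noncrossing_subset[OF NC_onD(2)[OF \<tau>]]) blast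
  ultimately show "?\<tau> \<in> NC_on {u \<in> T. Q u}" by (simp add: NC_on_def)
qed

text \<open>A block of mixed parity kills its summand. Any other \<open>\<tau>\<close> splits
  uniquely into odd and even blocks, and its being noncrossing makes the two halves compatible. The
  function \<open>c\<close> stands for the cumulant of an alternating word along a set of
  positions.\<close>

lemma sum_NC_interlace:
  fixes c :: "nat set \<Rightarrow> complex"
  assumes c: "\<And>U u v. U \<subseteq> {1..2 * n} \<Longrightarrow> u \<in> U \<Longrightarrow> v \<in> U \<Longrightarrow> even u \<Longrightarrow> odd v \<Longrightarrow> c U = 0"
  shows "(\<Sum>\<tau>\<in>NC (2 * n). \<Prod>U\<in>\<tau>. c U) = (\<Sum>\<pi>\<in>NC n. \<Sum>\<sigma> | \<sigma> \<in> NC n \<and> compat \<pi> \<sigma>.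
    (\<Prod>P\<in>\<pi>. c ((\<lambda>i. 2 * i - 1) ` P)) * (\<Prod>W\<in>\<sigma>. c ((\<lambda>i. 2 * i) ` W)))"
proof -
  \<comment> \<open>\<open>?r\<close> undoes both encodings: it sends \<open>2 * i - 1\<close> and
    \<open>2 * i\<close> to \<open>i\<close>.\<close>
  let ?o = "\<lambda>i::nat. 2 * i - 1" and ?e = "\<lambda>i::nat. 2 * i" and ?r = "\<lambda>u::nat. (u + 1) div 2"
  let ?H = "{\<tau> \<in> NC (2 * n). \<forall>U\<in>\<tau>. \<forall>u\<in>U. \<forall>v\<in>U. even u = even v}"
  let ?D = "\<lambda>\<pi>. {\<sigma> \<in> NC n. compat \<pi> \<sigma>}"
  let ?odd = "\<lambda>\<tau>. (`) ?r ` {U \<in> \<tau>. \<forall>u\<in>U. odd u}" and ?even = "\<lambda>\<tau>. (`) ?r ` {U \<in> \<tau>. \<forall>u\<in>U. even u}"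
  have block: "P \<subseteq> {1..m}" "P \<noteq> {}" "finite P" if "P \<in> \<pi>" "\<pi> \<in> NC m" for P \<pi> m
    using NC_onD(3,4)[of \<pi> "{1..m}" P] that finite_subset[of P "{1..m}"] by (auto simp: NC_eq_NC_on)
  have finpart: "finite \<pi>" if "\<pi> \<in> NC m" for \<pi> m
    using that finite_elements[of "{1..m}" \<pi>] by (simp add: NC_def)
  have ro: "?r ` ?o ` P = P" if "P \<subseteq> {1..n}" for P
  proof -
    have "?r (?o i) = i" if "i \<in> P" for i using that \<open>P \<subseteq> _\<close> by (cases i) auto
    then show ?thesis by (force simp: image_image)
  qed
  have re: "?r ` ?e ` P = P" for P by (force simp: image_image)
  have or: "?o ` ?r ` U = U" if "\<forall>u\<in>U. odd u" for U
  proof -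
    have "?o (?r u) = u" if "u \<in> U" for u using \<open>\<forall>u\<in>U. odd u\<close> that by (auto elim!: oddE)
    then show ?thesis by (force simp: image_image)
  qed
  have er: "?e ` ?r ` U = U" if "\<forall>u\<in>U. even u" for U
  proof -
    have "?e (?r u) = u" if "u \<in> U" for u using \<open>\<forall>u\<in>U. even u\<close> that by (auto elim!: evenE)
    then show ?thesis by (force simp: image_image)
  qed
  have oddpart: "{U \<in> interlace \<pi> \<sigma>. \<forall>u\<in>U. odd u} = (`) ?o ` \<pi>"
    and evenpart: "{U \<in> interlace \<pi> \<sigma>. \<forall>u\<in>U. even u} = (`) ?e ` \<sigma>"
    if \<pi>: "\<pi> \<in> NC n" and \<sigma>: "\<sigma> \<in> NC n" for \<pi> \<sigma>
  proof -
    have o: "U \<noteq> {} \<and> (\<forall>u\<in>U. odd u)" if "U \<in> (`) ?o ` \<pi>" for U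
      using that block[OF _ \<pi>] by force
    have e: "U \<noteq> {} \<and> (\<forall>u\<in>U. even u)" if "U \<in> (`) ?e ` \<sigma>" for U
      using that block[OF _ \<sigma>] by auto
    have filter: "{U \<in> C. R U} = D" if "C = D \<union> F" "\<And>U. U \<in> D \<Longrightarrow> R U" "\<And>U. U \<in> F \<Longrightarrow> \<not> R U"
      for C D F :: "nat set set" and R
      using that by blast
    show "{U \<in> interlace \<pi> \<sigma>. \<forall>u\<in>U. odd u} = (`) ?o ` \<pi>"
    proof (rule filter)
      show "interlace \<pi> \<sigma> = (`) ?o ` \<pi> \<union> (`) ?e ` \<sigma>" by (simp add: interlace_def)
      show "\<not> (\<forall>u\<in>U. odd u)" if "U \<in> (`) ?e ` \<sigma>" for U using e[OF that] by blast
    qed (use o in blast)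
    show "{U \<in> interlace \<pi> \<sigma>. \<forall>u\<in>U. even u} = (`) ?e ` \<sigma>"
    proof (rule filter)
      show "interlace \<pi> \<sigma> = (`) ?e ` \<sigma> \<union> (`) ?o ` \<pi>" by (simp add: interlace_def Un_commute)
      show "\<not> (\<forall>u\<in>U. even u)" if "U \<in> (`) ?o ` \<pi>" for U using o[OF that] by blast
    qed (use e in blast)
  qed
  have hom: "interlace \<pi> \<sigma> \<in> ?H" if "\<pi> \<in> NC n" "\<sigma> \<in> NC n" "compat \<pi> \<sigma>" for \<pi> \<sigma>
  proof -
    have "even u = even v" if "U \<in> interlace \<pi> \<sigma>" "u \<in> U" "v \<in> U" for U u v
    proof -
      have "interlace \<pi> \<sigma> = {U \<in> interlace \<pi> \<sigma>. \<forall>u\<in>U. odd u} \<union> {U \<in> interlace \<pi> \<sigma>. \<forall>u\<in>U. even u}"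
        unfolding oddpart[OF \<open>\<pi> \<in> NC n\<close> \<open>\<sigma> \<in> NC n\<close>] evenpart[OF \<open>\<pi> \<in> NC n\<close> \<open>\<sigma> \<in> NC n\<close>]
        by (simp add: interlace_def)
      then show ?thesis using that by blast
    qed
    then show ?thesis using NC_interlace[OF that] by blast
  qed
  have image_id: "(`) f ` \<pi> = \<pi>" if "\<And>P. P \<in> \<pi> \<Longrightarrow> f ` P = P" for f :: "nat \<Rightarrow> nat" and \<pi>
    using that by force
  have "(\<Sum>\<tau>\<in>NC (2 * n). \<Prod>U\<in>\<tau>. c U) = (\<Sum>\<tau>\<in>?H. \<Prod>U\<in>\<tau>. c U)"
  proof (rule sum.mono_neutral_right)
    show "\<forall>\<tau>\<in>NC (2 * n) - ?H. (\<Prod>U\<in>\<tau>. c U) = 0"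
    proof
      fix \<tau> assume "\<tau> \<in> NC (2 * n) - ?H"
      then obtain U u v where U: "\<tau> \<in> NC (2 * n)" "U \<in> \<tau>" "u \<in> U" "v \<in> U" "even u \<noteq> even v"
        by blast
      have sub: "U \<subseteq> {1..2 * n}" using block[OF U(2,1)] by blast
      have "c U = 0" using c[OF sub U(3,4)] c[OF sub U(4,3)] U(5) by blast
      then show "(\<Prod>U\<in>\<tau>. c U) = 0" using U(2) finpart[OF U(1)] by auto
    qed
  qed (use finite_NC in blast)+
  also have "\<dots> = (\<Sum>(\<pi>, \<sigma>)\<in>(SIGMA \<pi>:NC n. ?D \<pi>). (\<Prod>P\<in>\<pi>. c (?o ` P)) * (\<Prod>W\<in>\<sigma>. c (?e ` W)))"
  proof (rule sum.reindex_bij_witness[where i = "\<lambda>(\<pi>, \<sigma>). interlace \<pi> \<sigma>" and j = "\<lambda>\<tau>. (?odd \<tau>, ?even \<tau>)"])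
    fix \<tau> assume H: "\<tau> \<in> ?H"
    then have "\<tau> \<in> NC (2 * n)" by blast
    then have \<tau>: "\<tau> \<in> NC_on {1..2 * n}" "\<tau> \<in> NC (2 * n)" by (simp_all add: NC_eq_NC_on)
    have h: "even u \<longleftrightarrow> even v" if "U \<in> \<tau>" "u \<in> U" "v \<in> U" for U u v
      by (rule H[THEN CollectD, THEN conjunct2, THEN bspec, THEN bspec, THEN bspec]) (fact that)+
    have "(\<forall>u\<in>U. odd u) \<or> (\<forall>u\<in>U. even u)" if "U \<in> \<tau>" for U using h[OF that] by blast
    then have oe: "\<tau> = {U \<in> \<tau>. \<forall>u\<in>U. odd u} \<union> {U \<in> \<tau>. \<forall>u\<in>U. even u}" by blast
    have O: "?odd \<tau> \<in> NC n"
    proof -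
      have "strict_mono_on {u \<in> {1..2 * n}. odd u} ?r"
        by (rule strict_mono_onI) (auto elim!: oddE)
      then have "?odd \<tau> \<in> NC_on (?r ` {u \<in> {1..2 * n}. odd u})"
        by (rule blocks_of_parity[OF \<tau>(1), rotated]) (use h in blast)
      moreover have "?r ` {u \<in> {1..2 * n}. odd u} = {1..n}"
      proof (intro equalityI subsetI)
        fix i assume "i \<in> {1..n}"
        then obtain j where "i = Suc j" "j < n" by (cases i) auto
        then have "?o i \<in> {u \<in> {1..2 * n}. odd u}" "i = ?r (?o i)" by auto
        then show "i \<in> ?r ` {u \<in> {1..2 * n}. odd u}" by blast
      qed (auto elim!: oddE)
      ultimately show ?thesis by (simp only: NC_eq_NC_on)
    qed
    have E: "?even \<tau> \<in> NC n"
    proof -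
      have "strict_mono_on {u \<in> {1..2 * n}. even u} ?r"
        by (rule strict_mono_onI) (auto elim!: evenE)
      then have "?even \<tau> \<in> NC_on (?r ` {u \<in> {1..2 * n}. even u})"
        by (rule blocks_of_parity[OF \<tau>(1), rotated]) (use h in blast)
      moreover have "?r ` {u \<in> {1..2 * n}. even u} = {1..n}"
      proof (intro equalityI subsetI)
        fix i assume "i \<in> {1..n}"
        then have "?e i \<in> {u \<in> {1..2 * n}. even u}" "i = ?r (?e i)" by auto
        then show "i \<in> ?r ` {u \<in> {1..2 * n}. even u}" by blast
      qed (auto elim!: evenE)
      ultimately show ?thesis by (simp only: NC_eq_NC_on)
    qed
    have "(`) ?o ` ?odd \<tau> = {U \<in> \<tau>. \<forall>u\<in>U. odd u}" "(`) ?e ` ?even \<tau> = {U \<in> \<tau>. \<forall>u\<in>U. even u}"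
      unfolding image_image[of "(`) _" "(`) _"] using or er by simp_all
    then have I: "interlace (?odd \<tau>) (?even \<tau>) = \<tau>" using oe unfolding interlace_def by simp
    then show "(case (?odd \<tau>, ?even \<tau>) of (\<pi>, \<sigma>) \<Rightarrow> interlace \<pi> \<sigma>) = \<tau>" by simp
    have "compat (?odd \<tau>) (?even \<tau>)"
      using compat_iff_noncrossing_interlace[OF O E] NC_onD(2)[OF \<tau>(1)] I by metis
    then show "(?odd \<tau>, ?even \<tau>) \<in> (SIGMA \<pi>:NC n. ?D \<pi>)" using O E by blast
    have prods: "(\<Prod>P\<in>(`) ?r ` \<upsilon>. c (f ` P)) = (\<Prod>U\<in>\<upsilon>. c U)"
      if "\<And>U. U \<in> \<upsilon> \<Longrightarrow> f ` ?r ` U = U" for f and \<upsilon> :: "nat set set"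
    proof (subst prod.reindex)
      show "inj_on ((`) ?r) \<upsilon>" by (rule inj_on_inverseI[where g = "(`) f"]) (rule that)
    qed (use that in \<open>simp cong: prod.cong\<close>)
    have "(\<Prod>P\<in>?odd \<tau>. c (?o ` P)) = (\<Prod>U\<in>{U \<in> \<tau>. \<forall>u\<in>U. odd u}. c U)"
      by (rule prods[where f = ?o and \<upsilon> = "{U \<in> \<tau>. \<forall>u\<in>U. odd u}"]) (rule or, simp)
    moreover have "(\<Prod>P\<in>?even \<tau>. c (?e ` P)) = (\<Prod>U\<in>{U \<in> \<tau>. \<forall>u\<in>U. even u}. c U)"
      by (rule prods[where f = ?e and \<upsilon> = "{U \<in> \<tau>. \<forall>u\<in>U. even u}"]) (rule er, simp)
    moreover have "(\<Prod>U\<in>\<tau>. c U) = (\<Prod>U\<in>{U \<in> \<tau>. \<forall>u\<in>U. odd u}. c U) * (\<Prod>U\<in>{U \<in> \<tau>. \<forall>u\<in>U. even u}. c U)"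
    proof (subst oe, rule prod.union_disjoint)
      \<comment> \<open>Blocks are nonempty; the empty set would count as both odd and even.\<close>
      show "{U \<in> \<tau>. \<forall>u\<in>U. odd u} \<inter> {U \<in> \<tau>. \<forall>u\<in>U. even u} = {}"
        using NC_onD(4)[OF \<tau>(1)] by fastforce
    qed (use finpart[OF \<tau>(2)] in auto)
    ultimately show "(case (?odd \<tau>, ?even \<tau>) of (\<pi>, \<sigma>) \<Rightarrow>
        (\<Prod>P\<in>\<pi>. c (?o ` P)) * (\<Prod>W\<in>\<sigma>. c (?e ` W))) = (\<Prod>U\<in>\<tau>. c U)"
      by simp
  next
    fix p assume "p \<in> (SIGMA \<pi>:NC n. ?D \<pi>)"
    then obtain \<pi> \<sigma> where p: "p = (\<pi>, \<sigma>)" "\<pi> \<in> NC n" "\<sigma> \<in> NC n" "compat \<pi> \<sigma>" by blast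
    show "(case p of (\<pi>, \<sigma>) \<Rightarrow> interlace \<pi> \<sigma>) \<in> ?H" unfolding p(1) prod.case by (rule hom[OF p(2-4)])
    have "?odd (interlace \<pi> \<sigma>) = \<pi>"
      unfolding oddpart[OF p(2,3)] image_image[of "(`) _" "(`) _"] using ro block[OF _ p(2)] by simp
    moreover have "?even (interlace \<pi> \<sigma>) = \<sigma>"
      unfolding evenpart[OF p(2,3)] image_image[of "(`) _" "(`) _"] using re by simp
    ultimately show "(?odd (case p of (\<pi>, \<sigma>) \<Rightarrow> interlace \<pi> \<sigma>), ?even (case p of (\<pi>, \<sigma>) \<Rightarrow> interlace \<pi> \<sigma>)) = p"
      using p(1) by simp
  qed
  also have "\<dots> = (\<Sum>\<pi>\<in>NC n. \<Sum>\<sigma>\<in>?D \<pi>. (\<Prod>P\<in>\<pi>. c (?o ` P)) * (\<Prod>W\<in>\<sigma>. c (?e ` W)))"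
    by (rule sum.Sigma[symmetric]) (auto simp: finite_NC)
  finally show ?thesis .
qed

section \<open>Alternating words and cumulants of products\<close>

definition alternate :: "('b \<Rightarrow> 'a) \<Rightarrow> ('b \<Rightarrow> 'a) \<Rightarrow> 'b list \<Rightarrow> 'a list"
  where "alternate x y w = concat (map (\<lambda>i. [x i, y i]) w)"

lemma length_alternate: "length (alternate x y w) = 2 * length w"
  unfolding alternate_def by (induction w) auto

lemma nth_alternate:
  "i < length w \<Longrightarrow> alternate x y w ! (2 * i) = x (w ! i)"
  "i < length w \<Longrightarrow> alternate x y w ! Suc (2 * i) = y (w ! i)"
  unfolding alternate_def
  by (induction w arbitrary: i) (auto simp: nth_Cons' numeral_2_eq_2 split: if_splits simp flip: Suc_diff_Suc dest: gr0_implies_Suc)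

lemma prod_list_alternate:
  fixes x y :: "'b \<Rightarrow> 'a::monoid_mult"
  shows "prod_list (alternate x y w) = prod_list (map (\<lambda>i. x i * y i) w)"
  unfolding alternate_def by (induction w) (auto simp: mult.assoc)

text \<open>With positions counted from \<open>1\<close>, entries from \<open>x\<close> stand at the
  codes of the points and entries from \<open>y\<close> at the codes of the barred points. The two
  kinds of blocks of \<open>interlace\<close> therefore cut out pure words.\<close>

lemma subword_alternate:
  assumes P: "P \<subseteq> {1..length w}"
  shows "subword (alternate x y w) ((\<lambda>i. 2 * i - 1) ` P) = map x (subword w P)"
    and "subword (alternate x y w) ((\<lambda>i. 2 * i) ` P) = map y (subword w P)"
proof -
  have fin: "finite P" using P finite_subset by blast
  have "strict_mono_on P (\<lambda>i. 2 * i - 1 :: nat)" using P by (intro strict_mono_onI) auto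
  note o = sorted_list_of_set_image[OF fin this]
  have "strict_mono_on P (\<lambda>i. 2 * i :: nat)" by (intro strict_mono_onI) auto
  note e = sorted_list_of_set_image[OF fin this]
  have sub: "(\<lambda>i. 2 * i - 1) ` P \<subseteq> {1..length (alternate x y w)}"
    "(\<lambda>i. 2 * i) ` P \<subseteq> {1..length (alternate x y w)}"
    using P by (force simp: length_alternate)+
  have i: "2 * i - 1 - 1 = 2 * (i - 1)" "2 * i - 1 = Suc (2 * (i - 1))" "i - 1 < length w" if "i \<in> P" for i
    using that P by force+
  show "subword (alternate x y w) ((\<lambda>i. 2 * i - 1) ` P) = map x (subword w P)"
    unfolding subword_eq_map[OF sub(1)] o subword_eq_map[OF P] map_map
    by (rule map_cong[OF refl]) (use i fin in \<open>auto simp: nth_alternate\<close>)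
  show "subword (alternate x y w) ((\<lambda>i. 2 * i) ` P) = map y (subword w P)"
    unfolding subword_eq_map[OF sub(2)] e subword_eq_map[OF P] map_map
    by (rule map_cong[OF refl]) (use i fin in \<open>auto simp: nth_alternate\<close>)
qed

text \<open>The form in which freeness enters: products are expanded into alternating words and sums
  into words of summands, so the entries of the cumulants are the generators themselves.\<close>

definition mixed_cumulants_vanish :: "('a::ring_1 \<Rightarrow> complex) \<Rightarrow> 'a set \<Rightarrow> 'a set \<Rightarrow> bool"
  where "mixed_cumulants_vanish E X Y \<longleftrightarrow>
    (\<forall>as \<epsilon>. (\<forall>i<length as. as ! i \<in> (if \<epsilon> i then X else Y)) \<and>
      (\<exists>i<length as. \<epsilon> i) \<and> (\<exists>i<length as. \<not> \<epsilon> i) \<longrightarrow> cumulant E as = 0)"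

lemma mixed_cumulants_vanishD:
  assumes "mixed_cumulants_vanish E X Y"
    and "\<And>i. i < length as \<Longrightarrow> as ! i \<in> (if \<epsilon> i then X else Y)"
    and "i < length as" "\<epsilon> i" "j < length as" "\<not> \<epsilon> j"
  shows "cumulant E as = 0"
  using assms unfolding mixed_cumulants_vanish_def by blast

lemma free_in_imp_mixed_cumulants_vanish:
  assumes "free_in scale A E X Y"
  shows "mixed_cumulants_vanish E X Y"
  unfolding mixed_cumulants_vanish_def
proof (intro allI impI)
  fix as \<epsilon>
  assume *: "(\<forall>i<length as. as ! i \<in> (if \<epsilon> i then X else Y)) \<and>
      (\<exists>i<length as. \<epsilon> i) \<and> (\<exists>i<length as. \<not> \<epsilon> i)"
  have "X \<subseteq> unital_subalgebra scale hull X" "Y \<subseteq> unital_subalgebra scale hull Y"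
    by (rule hull_subset)+
  then have "\<forall>i<length as. as ! i \<in> (if \<epsilon> i then unital_subalgebra scale hull X
      else unital_subalgebra scale hull Y)"
    using * by (metis subsetD)
  with assms * show "cumulant E as = 0" unfolding free_in_def by blast
qed

lemma cumulant_alternate_mixed:
  assumes free: "mixed_cumulants_vanish E X Y"
    and w: "x ` set w \<subseteq> X" "y ` set w \<subseteq> Y"
    and U: "U \<subseteq> {1..2 * length w}" "u \<in> U" "v \<in> U" "even u" "odd v"
  shows "cumulant E (subword (alternate x y w) U) = 0"
proof -
  let ?zs = "alternate x y w" and ?l = "sorted_list_of_set U"
  have fin: "finite U" using U(1) finite_subset by blast
  have eq: "subword ?zs U = map (\<lambda>i. ?zs ! (i - 1)) ?l"
    using U(1) by (intro subword_eq_map) (simp add: length_alternate)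
  obtain i j where ij: "i < length ?l" "?l ! i = v" "j < length ?l" "?l ! j = u"
    using U(2,3) fin by (metis in_set_conv_nth set_sorted_list_of_set)
  \<comment> \<open>Entries are labelled by the parity of their position in the alternating word;
    \<open>v\<close> and \<open>u\<close> witness that both labels occur.\<close>
  show ?thesis
  proof (rule mixed_cumulants_vanishD[OF free, where \<epsilon> = "\<lambda>i. odd (?l ! i)" and i = i and j = j])
    fix m assume "m < length (subword ?zs U)"
    then have m: "m < length ?l" by (simp add: eq)
    have tU: "?l ! m \<in> {1..2 * length w}" using U(1) fin m nth_mem[OF m] by auto
    show "subword ?zs U ! m \<in> (if odd (?l ! m) then X else Y)"
    proof (cases "odd (?l ! m)")
      case True
      then obtain k where k: "?l ! m = 2 * k + 1" by (rule oddE)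
      then have "k < length w" using tU by simp
      then show ?thesis using m k w nth_mem[of k w] by (auto simp: eq nth_alternate)
    next
      case False
      then obtain k where k: "?l ! m = 2 * Suc k" using tU
        by (metis evenE atLeastAtMost_iff mult_0_right not_one_le_zero old.nat.exhaust)
      then have "k < length w" using tU by simp
      then show ?thesis using m k w nth_mem[of k w] by (auto simp: eq nth_alternate)
    qed
  qed (use ij U in \<open>auto simp: eq\<close>)
qed

text \<open>The moment of a word in the products is the moment of the alternating word of twice the
  length, so no cumulant with products as entries has to be expanded. \<open>f\<close> and
  \<open>g\<close> are prescribed only on nonempty words in the letters of \<open>w\<close>, which
  suits R-transforms, as these vanish on other letters.\<close>

lemma cumulant_product:
  fixes x y :: "nat \<Rightarrow> 'a::ring_1"
  assumes free: "mixed_cumulants_vanish E X Y"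
    and w: "w \<noteq> []" "x ` set w \<subseteq> X" "y ` set w \<subseteq> Y"
    and f: "\<And>v. v \<noteq> [] \<Longrightarrow> set v \<subseteq> set w \<Longrightarrow> f v = cumulant E (map x v)"
    and g: "\<And>v. v \<noteq> [] \<Longrightarrow> set v \<subseteq> set w \<Longrightarrow> g v = cumulant E (map y v)"
  shows "cumulant E (map (\<lambda>i. x i * y i) w) = boxed_convolution f g w"
proof (rule cumulant_eqI[OF w(1)])
  fix V assume V: "V \<subseteq> {1..length w}" "V \<noteq> {}"
  define v where "v = subword w V"
  have len: "length v = card V" unfolding v_def by (rule length_subword[OF V(1)])
  have v: "v \<noteq> []" "set v \<subseteq> set w"
    using V subword_Nil_iff[OF V(1)] set_subword_subset[of w V] by (simp_all add: v_def)
  let ?c = "\<lambda>U. cumulant E (subword (alternate x y v) U)"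
  have "E (prod_list (map (\<lambda>i. x i * y i) v)) = (\<Sum>\<tau>\<in>NC (2 * length v). \<Prod>U\<in>\<tau>. ?c U)"
  proof -
    have "alternate x y v \<noteq> []" using v(1) length_alternate[of x y v] by fastforce
    from moment_cumulant[OF this, of E] show ?thesis by (simp add: prod_list_alternate length_alternate)
  qed
  also have "\<dots> = (\<Sum>\<pi>\<in>NC (length v). \<Sum>\<sigma> | \<sigma> \<in> NC (length v) \<and> compat \<pi> \<sigma>.
      (\<Prod>P\<in>\<pi>. ?c ((\<lambda>i. 2 * i - 1) ` P)) * (\<Prod>W\<in>\<sigma>. ?c ((\<lambda>i. 2 * i) ` W)))"
  proof (rule sum_NC_interlace, rule cumulant_alternate_mixed[OF free])
    show "x ` set v \<subseteq> X" "y ` set v \<subseteq> Y" using w v(2) by blast+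
  qed
  also have "\<dots> = (\<Sum>\<pi>\<in>NC (length v). \<Sum>\<sigma> | \<sigma> \<in> NC (length v) \<and> compat \<pi> \<sigma>.
      (\<Prod>P\<in>\<pi>. f (subword v P)) * (\<Prod>W\<in>\<sigma>. g (subword v W)))"
  proof -
    have "?c ((\<lambda>i. 2 * i - 1) ` P) = f (subword v P)" "?c ((\<lambda>i. 2 * i) ` P) = g (subword v P)"
      if "\<pi> \<in> NC (length v)" "P \<in> \<pi>" for \<pi> P
    proof -
      have P: "P \<subseteq> {1..length v}" "P \<noteq> {}" using NC_onD(3,4) that by (auto simp: NC_eq_NC_on)
      have ne: "subword v P \<noteq> []" "set (subword v P) \<subseteq> set w"
        using P subword_Nil_iff[OF P(1)] set_subword_subset[of v P] v(2) by blast+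
      show "?c ((\<lambda>i. 2 * i - 1) ` P) = f (subword v P)" "?c ((\<lambda>i. 2 * i) ` P) = g (subword v P)"
        by (simp_all only: subword_alternate[OF P(1)] f[OF ne] g[OF ne])
    qed
    then show ?thesis by (intro sum.cong prod.cong refl arg_cong2[where f = "(*)"]) auto
  qed
  also have "\<dots> = (\<Sum>\<rho>\<in>NC (length v). \<Prod>U\<in>\<rho>. boxed_convolution f g (subword v U))"
    by (rule sum_NC_boxed_convolution[symmetric])
  finally show "E (prod_list (map (\<lambda>i. x i * y i) (subword w V)))
      = (\<Sum>\<sigma>\<in>NC (card V). \<Prod>U\<in>\<sigma>. boxed_convolution f g (subword (subword w V) U))"
    by (simp add: v_def len[unfolded v_def])
qed

subsection \<open>Cumulants of sums\<close>

text \<open>In each partition exactly one block contains the position of \<open>a + b\<close>, so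
  exactly one factor of the product is additive in it and the others stay fixed. \<open>S\<close> is
  a domain on which \<open>E\<close> is known to be additive.\<close>

lemma cumulant_add:
  fixes a b :: "'a::ring_1"
  assumes add: "\<And>p q. p \<in> S \<Longrightarrow> q \<in> S \<Longrightarrow> E (p + q) = E p + E q"
    and mult: "\<And>p q. p \<in> S \<Longrightarrow> q \<in> S \<Longrightarrow> p * q \<in> S" and one: "1 \<in> S"
    and us: "set us \<subseteq> S" and vs: "set vs \<subseteq> S" and ab: "a \<in> S" "b \<in> S"
  shows "cumulant E (us @ (a + b) # vs) = cumulant E (us @ a # vs) + cumulant E (us @ b # vs)"
proof -
  let ?n = "length us + Suc (length vs)" and ?k = "Suc (length us)"
  have prod: "prod_list ps \<in> S" if "set ps \<subseteq> S" for ps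
    using that by (induction ps) (auto intro: one mult)
  \<comment> \<open>Index \<open>j\<close> of \<open>vs\<close> is position
    \<open>j + length us + 2\<close> of the whole word: one for the middle entry, one because
    positions start at \<open>1\<close>.\<close>
  let ?r = "\<lambda>c V. nths us {i. Suc i \<in> V} @ (if ?k \<in> V then [c] else [])
      @ nths vs {j. Suc (Suc (j + length us)) \<in> V}"
  have sub: "subword (us @ c # vs) V = ?r c V" for c V
    by (simp add: subword_def nths_append nths_Cons)
  have out: "E (prod_list (subword (us @ c # vs) V)) = E (prod_list (subword (us @ d # vs) V))"
    if "?k \<notin> V" for c d V
    using that by (simp add: sub)
  have inn: "E (prod_list (subword (us @ (a + b) # vs) V))
      = E (prod_list (subword (us @ a # vs) V)) + E (prod_list (subword (us @ b # vs) V))"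
    if "?k \<in> V" for V
  proof -
    define p q where "p = prod_list (nths us {i. Suc i \<in> V})"
      and "q = prod_list (nths vs {j. Suc (Suc (j + length us)) \<in> V})"
    have pq: "p \<in> S" "q \<in> S"
      unfolding p_def q_def by (rule prod, use us vs set_nths_subset in fast)+
    have "E (p * (a * q) + p * (b * q)) = E (p * (a * q)) + E (p * (b * q))"
      using pq ab by (intro add mult)
    then show ?thesis using that by (simp add: sub p_def q_def algebra_simps)
  qed
  have "(\<Prod>V\<in>\<pi>. E (prod_list (subword (us @ (a + b) # vs) V)))
      = (\<Prod>V\<in>\<pi>. E (prod_list (subword (us @ a # vs) V))) + (\<Prod>V\<in>\<pi>. E (prod_list (subword (us @ b # vs) V)))"
    if \<pi>: "\<pi> \<in> NC ?n" for \<pi>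
  proof -
    have P: "partition_on {1..?n} \<pi>" using \<pi> by (simp add: NC_def)
    have "?k \<in> {1..?n}" by simp
    then obtain V where V: "V \<in> \<pi>" "?k \<in> V" using partition_onD1[OF P] by blast
    have fin: "finite \<pi>" using P finite_elements by blast
    have "?k \<notin> W" if "W \<in> \<pi> - {V}" for W using partition_on_same_block[OF P V(1)] that V by blast
    then have "(\<Prod>W\<in>\<pi> - {V}. E (prod_list (subword (us @ c # vs) W)))
        = (\<Prod>W\<in>\<pi> - {V}. E (prod_list (subword (us @ d # vs) W)))" for c d
      by (intro prod.cong refl out) auto
    note this[of "a + b" b] this[of a b]
    then show ?thesis
      by (simp only: prod.remove[OF fin V(1)] inn[OF V(2)] distrib_right)
  qed
  then show ?thesis
    by (simp add: cumulant_def sum.distrib[symmetric] distrib_right)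
qed

text \<open>Functionals of different levels of the tower are only known to agree on a common
  subalgebra; closure of \<open>S\<close> under products keeps all the moments in it.\<close>

lemma cumulant_cong:
  assumes E: "\<And>p. p \<in> S \<Longrightarrow> E p = E' p"
    and mult: "\<And>p q. p \<in> S \<Longrightarrow> q \<in> S \<Longrightarrow> p * q \<in> S" and one: "1 \<in> S"
    and as: "set as \<subseteq> S"
  shows "cumulant E as = cumulant E' as"
proof -
  have prod: "prod_list ps \<in> S" if "set ps \<subseteq> S" for ps
    using that by (induction ps) (auto intro: one mult)
  have "E (prod_list (subword as V)) = E' (prod_list (subword as V))" for V
    by (rule E[OF prod[OF subset_trans[OF set_subword_subset as]]])
  then show ?thesis by (simp add: cumulant_def)
qed

text \<open>The prefix \<open>ls\<close> records a choice of one summand for each letter expanded so far.\<close>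

lemma cumulant_sum_prefix:
  fixes x y :: "'b \<Rightarrow> 'a::ring_1" and ls :: "(bool \<times> 'b) list"
  defines "z \<equiv> \<lambda>(b, i). if b then x i else y i"
  assumes free: "mixed_cumulants_vanish E X Y"
    and xy: "x ` I \<subseteq> X" "y ` I \<subseteq> Y" and S: "X \<subseteq> S" "Y \<subseteq> S"
    and add: "\<And>p q. p \<in> S \<Longrightarrow> q \<in> S \<Longrightarrow> E (p + q) = E p + E q"
    and plus: "\<And>p q. p \<in> S \<Longrightarrow> q \<in> S \<Longrightarrow> p + q \<in> S"
    and mult: "\<And>p q. p \<in> S \<Longrightarrow> q \<in> S \<Longrightarrow> p * q \<in> S" and one: "1 \<in> S"
    and I: "snd ` set ls \<subseteq> I" "set w \<subseteq> I" and ne: "ls \<noteq> [] \<or> w \<noteq> []"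
  shows "cumulant E (map z ls @ map (\<lambda>i. x i + y i) w)
    = (if \<forall>p\<in>set ls. fst p then cumulant E (map z ls @ map x w) else 0)
    + (if \<forall>p\<in>set ls. \<not> fst p then cumulant E (map z ls @ map y w) else 0)"
  using I ne
proof (induction w arbitrary: ls)
  case Nil
  have z: "z p \<in> (if fst p then X else Y)" if "p \<in> set ls" for p
  proof -
    have "snd p \<in> I" using that Nil(1) by blast
    then show ?thesis using xy by (cases p) (auto simp: z_def)
  qed
  have mixed: "cumulant E (map z ls) = 0" if pq: "p \<in> set ls" "q \<in> set ls" "fst p" "\<not> fst q" for p q
  proof -
    obtain i j where ij: "i < length ls" "ls ! i = p" "j < length ls" "ls ! j = q"
      using pq by (metis in_set_conv_nth)
    show ?thesis
      by (rule mixed_cumulants_vanishD[OF free, where \<epsilon> = "\<lambda>i. fst (ls ! i)" and i = i and j = j])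
        (use ij pq z in auto)
  qed
  \<comment> \<open>As \<open>ls\<close> is nonempty, the two conditions on it exclude each other,
    so the cumulant is not counted twice.\<close>
  obtain p where p: "p \<in> set ls" using Nil(3) by (cases ls) auto
  show ?case
  proof (cases "\<forall>p\<in>set ls. fst p")
    case True
    then have "\<not> (\<forall>p\<in>set ls. \<not> fst p)" using p by blast
    then show ?thesis using True by simp
  next
    case False
    then obtain q where q: "q \<in> set ls" "\<not> fst q" by blast
    show ?thesis
    proof (cases "\<forall>p\<in>set ls. \<not> fst p")
      case True
      then show ?thesis using False by simp
    next
      case none: False
      then obtain r where r: "r \<in> set ls" "fst r" by blast
      show ?thesis unfolding if_not_P[OF False] if_not_P[OF none]
        using mixed[OF r(1) q(1) r(2) q(2)] by simp
    qed
  qed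
next
  case (Cons i w)
  have "z p \<in> S" if "p \<in> set ls" for p
  proof -
    have "snd p \<in> I" using that Cons(2) by blast
    then have "x (snd p) \<in> S" "y (snd p) \<in> S" using xy S by blast+
    then show ?thesis by (cases p) (simp add: z_def)
  qed
  then have zS: "set (map z ls) \<subseteq> S" by auto
  have i: "x i \<in> S" "y i \<in> S" and wS: "set (map (\<lambda>i. x i + y i) w) \<subseteq> S"
  proof -
    have xyS: "x j \<in> S" "y j \<in> S" if "j \<in> I" for j using that xy S by blast+
    then show "x i \<in> S" "y i \<in> S" "set (map (\<lambda>i. x i + y i) w) \<subseteq> S"
      using Cons(3) by (auto intro!: plus)
  qed
  have z: "z (True, i) = x i" "z (False, i) = y i" by (simp_all add: z_def)
  have "cumulant E (map z ls @ map (\<lambda>i. x i + y i) (i # w))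
      = cumulant E (map z (ls @ [(True, i)]) @ map (\<lambda>i. x i + y i) w)
      + cumulant E (map z (ls @ [(False, i)]) @ map (\<lambda>i. x i + y i) w)"
    using cumulant_add[OF add mult one zS wS i] z by simp
  \<comment> \<open>The new label \<open>True\<close> falsifies the second condition, which leaves
    only the summand with \<open>x\<close> in the induction hypothesis; the label
    \<open>False\<close> acts symmetrically.\<close>
  also have "cumulant E (map z (ls @ [(True, i)]) @ map (\<lambda>i. x i + y i) w)
      = (if \<forall>p\<in>set ls. fst p then cumulant E (map z ls @ map x (i # w)) else 0)"
    using Cons.IH[of "ls @ [(True, i)]"] Cons(2,3) z by simp
  also have "cumulant E (map z (ls @ [(False, i)]) @ map (\<lambda>i. x i + y i) w)
      = (if \<forall>p\<in>set ls. \<not> fst p then cumulant E (map z ls @ map y (i # w)) else 0)"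
    using Cons.IH[of "ls @ [(False, i)]"] Cons(2,3) z by simp
  finally show ?case .
qed

text \<open>Every partition has a block through a position with the letter \<open>i\<close>, and the
  factor of \<open>f\<close> there is zero. This settles the equality of series on words with
  letters outside \<open>{1..s}\<close>.\<close>

lemma boxed_convolution_eq_0:
  assumes "i \<in> set w" "\<And>v. i \<in> set v \<Longrightarrow> f v = 0"
  shows "boxed_convolution f g w = 0"
proof -
  have "(\<Prod>V\<in>\<pi>. f (subword w V)) = 0" if \<pi>: "\<pi> \<in> NC (length w)" for \<pi>
  proof -
    have P: "partition_on {1..length w} \<pi>" using \<pi> by (simp add: NC_def)
    obtain j where j: "j < length w" "w ! j = i" using assms(1) by (metis in_set_conv_nth)
    then have "Suc j \<in> {1..length w}" by simp
    then obtain V where V: "V \<in> \<pi>" "Suc j \<in> V" using partition_onD1[OF P] by blast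
    have "V \<subseteq> {1..length w}" using V(1) P by (auto simp: partition_on_def)
    from set_subword[OF this] have "i \<in> set (subword w V)" using V(2) j(2) by force
    then have "f (subword w V) = 0" by (rule assms(2))
    then show ?thesis using V(1) finite_elements[OF _ P] by auto
  qed
  then show ?thesis by (simp add: boxed_convolution_def)
qed

section \<open>Cumulants along the tower\<close>

context ncp_tower
begin

lemma A_mult: "p \<in> A j \<Longrightarrow> q \<in> A j \<Longrightarrow> p * q \<in> A j"
  and A_one: "1 \<in> A j"
  and A_add: "p \<in> A j \<Longrightarrow> q \<in> A j \<Longrightarrow> p + q \<in> A j"
  using unital_subalgebra_A[of j] by (auto simp: unital_subalgebra_def subspace_def)

lemma tower_E_add:
  assumes "p \<in> A j" "q \<in> A j"
  shows "tower_E \<phi>\<^sub>0 \<phi> j (p + q) = tower_E \<phi>\<^sub>0 \<phi> j p + tower_E \<phi>\<^sub>0 \<phi> j q"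
  using assms
proof (induction j arbitrary: p q)
  case 0
  then show ?case using linear_phi0 by (simp add: clinear_on_def)
next
  case (Suc j)
  have "\<phi> (Suc j) p \<in> A j" "\<phi> (Suc j) q \<in> A j" "\<phi> (Suc j) (p + q) = \<phi> (Suc j) p + \<phi> (Suc j) q"
    using cond_exp_phi[of j] Suc.prems by (auto simp: conditional_expectation_def clinear_on_def)
  then show ?case using Suc.IH by simp
qed

lemma cumulant_tower_E:
  assumes "set as \<subseteq> A i" "i \<le> j"
  shows "cumulant (tower_E \<phi>\<^sub>0 \<phi> j) as = cumulant (tower_E \<phi>\<^sub>0 \<phi> i) as"
  by (rule cumulant_cong[of "A i", OF _ A_mult A_one assms(1)]) (rule tower_E_eq[OF _ assms(2)])

lemma cumulant_tower_E_inf: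
  assumes "set as \<subseteq> A j"
  shows "cumulant (tower_E_inf A \<phi>\<^sub>0 \<phi>) as = cumulant (tower_E \<phi>\<^sub>0 \<phi> j) as"
  by (rule cumulant_cong[of "A j", OF _ A_mult A_one assms]) (rule tower_E_inf_eq)

end

theorem theorem2p10:
  fixes scale :: "complex \<Rightarrow> 'a::ring_1 \<Rightarrow> 'a"
    and A :: "nat \<Rightarrow> 'a set"
    and \<phi>\<^sub>0 :: "'a \<Rightarrow> complex"
    and \<phi> :: "nat \<Rightarrow> 'a \<Rightarrow> 'a"
    and k l s :: nat
    and x y :: "nat \<Rightarrow> 'a"
  assumes tower: "ncp_tower scale A \<phi>\<^sub>0 \<phi>"
    and kl: "k < l"
    and X: "x ` {1..s} \<subseteq> (\<Union>j\<in>{1..k}. A j)"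
    and Y: "y ` {1..s} \<subseteq> (\<Union>j\<in>{k + 1..l}. A j)"
    and free: "free_in scale (A l) (tower_E \<phi>\<^sub>0 \<phi> l) (x ` {1..s}) (y ` {1..s})"
  shows "R_transform (tower_E_inf A \<phi>\<^sub>0 \<phi>) (2 * s) (\<lambda>i. if i \<le> s then x i else y (i - s))
           = R_transform (tower_E \<phi>\<^sub>0 \<phi> k) s x + shift_vars s (R_transform (tower_E \<phi>\<^sub>0 \<phi> l) s y)
       \<and> R_transform (tower_E_inf A \<phi>\<^sub>0 \<phi>) s (\<lambda>i. x i + y i)
           = R_transform (tower_E \<phi>\<^sub>0 \<phi> k) s x + R_transform (tower_E \<phi>\<^sub>0 \<phi> l) s y
       \<and> R_transform (tower_E_inf A \<phi>\<^sub>0 \<phi>) s (\<lambda>i. x i * y i)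
           = boxed_convolution (R_transform (tower_E \<phi>\<^sub>0 \<phi> k) s x) (R_transform (tower_E \<phi>\<^sub>0 \<phi> l) s y)"
proof (intro conjI ext)
  interpret ncp_tower scale A \<phi>\<^sub>0 \<phi> by (rule tower)
  let ?El = "tower_E \<phi>\<^sub>0 \<phi> l" and ?Ek = "tower_E \<phi>\<^sub>0 \<phi> k" and ?Einf = "tower_E_inf A \<phi>\<^sub>0 \<phi>"
  let ?I = "{1..s}"
  note mixed = free_in_imp_mixed_cumulants_vanish[OF free]
  have xk: "x i \<in> A k" if "i \<in> ?I" for i using X A_mono[of _ k] that by fastforce
  have yl: "y i \<in> A l" if "i \<in> ?I" for i using Y A_mono[of _ l] that by fastforce
  have xl: "x i \<in> A l" if "i \<in> ?I" for i using xk[OF that] A_mono[of k l] kl by auto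
  \<comment> \<open>Freeness is given at level \<open>l\<close>, so the cumulants are compared
    there. Those of the \<open>x i\<close> descend to level \<open>k\<close>, because the
    expectations above \<open>k\<close> fix \<open>A k\<close>.\<close>
  have Ekl: "cumulant ?El (map x w) = cumulant ?Ek (map x w)" if "set w \<subseteq> ?I" for w
    by (rule cumulant_tower_E) (use xk that kl in auto)

  fix w
  show "R_transform ?Einf (2 * s) (\<lambda>i. if i \<le> s then x i else y (i - s)) w
      = (R_transform ?Ek s x + shift_vars s (R_transform ?El s y)) w"
  proof (cases "w \<noteq> [] \<and> set w \<subseteq> {1..2 * s}")
    case False
    \<comment> \<open>Here all the series vanish. For the shifted one, \<open>s < i\<close> guards
      the truncated difference \<open>i - s\<close>, so shifted letters in \<open>?I\<close> come
      from letters in \<open>{1..2 * s}\<close>.\<close>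
    have "\<not> set w \<subseteq> ?I" if "w \<noteq> []"
      using False that by fastforce
    moreover have "\<not> (\<lambda>i. i - s) ` set w \<subseteq> ?I" if "w \<noteq> []" "\<forall>i\<in>set w. s < i"
    proof
      assume *: "(\<lambda>i. i - s) ` set w \<subseteq> ?I"
      have "i \<in> {1..2 * s}" if "i \<in> set w" for i
      proof -
        have "i - s \<in> ?I" "s < i" using * that \<open>\<forall>i\<in>set w. s < i\<close> by blast+
        then show ?thesis by auto
      qed
      then show False using False \<open>w \<noteq> []\<close> by blast
    qed
    ultimately show ?thesis using False by (auto simp: R_transform_def shift_vars_def)
  next
    case True
    let ?a = "\<lambda>i. if i \<le> s then x i else y (i - s)"
    have a: "?a i \<in> (if i \<le> s then x ` ?I else y ` ?I)" if "i \<in> set w" for i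
    proof -
      have i: "i \<in> {1..2 * s}" using that True by blast
      show ?thesis
      proof (cases "i \<le> s")
        case False
        then have "i - s \<in> ?I" using i by auto
        then show ?thesis using False by simp
      qed (use i in auto)
    qed
    have "?a i \<in> A l" if "i \<in> set w" for i using a[OF that] xl yl by (auto split: if_splits)
    then have "set (map ?a w) \<subseteq> A l" unfolding set_map by blast
    then have inf: "cumulant ?Einf (map ?a w) = cumulant ?El (map ?a w)"
      by (rule cumulant_tower_E_inf)
    \<comment> \<open>Words purely in the \<open>x\<close> variables, purely in the \<open>y\<close>
      variables, and mixed words, whose cumulants vanish by freeness.\<close>
    consider "\<forall>i\<in>set w. i \<le> s" | "\<forall>i\<in>set w. s < i" | i j where "i \<in> set w" "i \<le> s" "j \<in> set w" "s < j"
      by (meson not_le)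
    then show ?thesis
    proof cases
      case 1
      then have I: "set w \<subseteq> ?I" using True by fastforce
      have m: "map ?a w = map x w" using 1 by simp
      \<comment> \<open>Nonemptiness of \<open>w\<close> is used: on the empty word the condition in
        \<open>shift_vars\<close> holds vacuously.\<close>
      have "\<not> (\<forall>i\<in>set w. s < i)" using 1 True by (metis list.set_sel(1) not_le)
      then have "shift_vars s (R_transform ?El s y) w = 0" unfolding shift_vars_def by (rule if_not_P)
      moreover have "cumulant ?Einf (map ?a w) = cumulant ?Ek (map x w)"
        using inf Ekl[OF I] unfolding m by (rule trans)
      ultimately show ?thesis using True I by (simp add: R_transform_def)
    next
      case 2
      then have I: "\<not> set w \<subseteq> ?I" using True by (metis atLeastAtMost_iff list.set_sel(1) not_le subsetD)
      have J: "set (map (\<lambda>i. i - s) w) \<subseteq> ?I"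
        unfolding set_map
      proof clarify
        fix i assume "i \<in> set w"
        then have "i \<in> {1..2 * s}" "s < i" using 2 True by blast+
        then show "i - s \<in> ?I" by auto
      qed
      have m: "map ?a w = map y (map (\<lambda>i. i - s) w)" using 2 by auto
      have "shift_vars s (R_transform ?El s y) w = R_transform ?El s y (map (\<lambda>i. i - s) w)"
        unfolding shift_vars_def by (rule if_P[OF 2])
      also have "\<dots> = cumulant ?El (map ?a w)"
        unfolding m R_transform_def using J True by simp
      also have "\<dots> = cumulant ?Einf (map ?a w)" by (rule inf[symmetric])
      finally show ?thesis using True I by (simp add: R_transform_def)
    next
      case 3
      obtain p q where pq: "p < length w" "w ! p = i" "q < length w" "w ! q = j"
        using 3 by (metis in_set_conv_nth)
      have "cumulant ?El (map ?a w) = 0"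
        by (rule mixed_cumulants_vanishD[OF mixed, where \<epsilon> = "\<lambda>p. w ! p \<le> s" and i = p and j = q])
          (use pq 3 a in \<open>auto split: if_splits\<close>)
      then have "cumulant ?Einf (map ?a w) = 0" using inf by (rule trans[rotated])
      moreover have "\<not> (\<forall>i\<in>set w. s < i)" using 3 by force
      then have "shift_vars s (R_transform ?El s y) w = 0" unfolding shift_vars_def by (rule if_not_P)
      moreover have "\<not> set w \<subseteq> ?I" using 3 by force
      ultimately show ?thesis using True by (simp add: R_transform_def)
    qed
  qed

  show "R_transform ?Einf s (\<lambda>i. x i + y i) w = (R_transform ?Ek s x + R_transform ?El s y) w"
  proof (cases "w \<noteq> [] \<and> set w \<subseteq> ?I")
    case True
    have "cumulant ?Einf (map (\<lambda>i. x i + y i) w) = cumulant ?El (map (\<lambda>i. x i + y i) w)"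
      using True xl yl by (intro cumulant_tower_E_inf) (auto intro!: A_add)
    \<comment> \<open>With the empty prefix both conditions on the labels hold vacuously, so both
      summands appear.\<close>
    also have "\<dots> = cumulant ?El (map x w) + cumulant ?El (map y w)"
      using cumulant_sum_prefix[OF mixed, of x ?I y "A l" "[]" w] True xl yl
      by (simp add: image_subset_iff tower_E_add A_add A_mult A_one)
    finally show ?thesis using True Ekl by (simp add: R_transform_def)
  qed (auto simp: R_transform_def)

  show "R_transform ?Einf s (\<lambda>i. x i * y i) w
      = boxed_convolution (R_transform ?Ek s x) (R_transform ?El s y) w"
  proof (cases "w \<noteq> [] \<and> set w \<subseteq> ?I")
    case True
    have "cumulant ?Einf (map (\<lambda>i. x i * y i) w) = cumulant ?El (map (\<lambda>i. x i * y i) w)"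
      using True xl yl by (intro cumulant_tower_E_inf) (auto intro!: A_mult)
    also have "\<dots> = boxed_convolution (R_transform ?Ek s x) (R_transform ?El s y) w"
    proof (rule cumulant_product[OF mixed])
      fix v :: "nat list" assume v: "v \<noteq> []" "set v \<subseteq> set w"
      then have "set v \<subseteq> ?I" using True by blast
      then show "R_transform ?Ek s x v = cumulant ?El (map x v)"
        and "R_transform ?El s y v = cumulant ?El (map y v)"
        using v Ekl by (simp_all add: R_transform_def)
    qed (use True in auto)
    finally show ?thesis using True by (simp add: R_transform_def)
  next
    case False
    have "boxed_convolution (R_transform ?Ek s x) (R_transform ?El s y) w = 0"
    proof (cases "w = []")
      case True
      then show ?thesis by (simp add: boxed_convolution_def)
    next
      case ne: False
      then obtain i where i: "i \<in> set w" "i \<notin> ?I" using False by blast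
      show ?thesis
        by (rule boxed_convolution_eq_0[OF i(1)]) (use i(2) in \<open>auto simp: R_transform_def\<close>)
    qed
    moreover have "R_transform ?Einf s (\<lambda>i. x i * y i) w = 0"
      using False by (auto simp: R_transform_def)
    ultimately show ?thesis by simp
  qed
qed

end
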